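(* Let $\Lambda$ be a finitely aligned left cancellative small category. Then $\mathcal{G}_{tight}(\mathcal{S}_\Lambda)$ is topologically isomorphic (isomorphic as a topological groupoid) to $\mathcal{S}_\Lambda\rtimes\Lambda_{tight}$.
   Context: Categories. A small category $\Lambda$ is identified with its set of morphisms, objects $\Lambda^0$ with identity morphisms; $s(\alpha)$ is the domain and $r(\alpha)$ the range of $\alpha$; $\alpha\beta$ is defined when $s(\alpha)=r(\beta)$; $\alpha\Lambda=\{\alpha\beta: r(\beta)=s(\alpha)\}$. $\Lambda$ is left cancellative if $\alpha\beta=\alpha\gamma$ implies $\beta=\gamma$; finitely aligned if for all $\alpha,\beta$ there is a finite $\Gamma\subset\Lambda$ with $\alpha\Lambda\cap\beta\Lambda=\bigcup_{\gamma\in\Gamma}\gamma\Lambda$. $\alpha\le\beta$ means $\beta\in\alpha\Lambda$; $[\beta]=\{\alpha:\alpha\le\beta\}$; $\alpha\Cap\beta$ means $\alpha\Lambda\cap\beta\Lambda\ne\emptyset$. Inverse semigroup. $\tau^\alpha:s(\alpha)\Lambda\to\alpha\Lambda$, $\beta\mapsto\alpha\beta$, $\sigma^\alpha:=(\tau^\alpha)^{-1}$; $\mathcal{S}_\Lambda$ is the inverse semigroup of partial bijections of $\Lambda$ generated by all of these; $\mathcal{E}$ is its semilattice of idempotents ($e\le f$ iff $e=ef$). Every $s\in\mathcal{S}_\Lambda$ is a finite join (union of partial maps) $s=\bigvee_{i=1}^n\tau^{\alpha_i}\sigma^{\beta_i}$ with $s(\alpha_i)=s(\beta_i)$. Groupoid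 of germs. For an action of an inverse semigroup $\mathcal{S}$ on a space $X$ by homeomorphisms $s\cdot:D_{s^*s}\to D_{ss^*}$ between open sets, $\mathcal{S}\rtimes X$ consists of the classes $[s,x]$, $x\in D_{s^*s}$, where $(s,x)\sim(t,y)$ iff $x=y$ and $se=te$ for some idempotent $e$ with $x\in D_e$; $d[s,x]=x$, $r[s,x]=s\cdot x$, $[s,t\cdot x][t,x]=[st,x]$, $[s,x]^{-1}=[s^*,s\cdot x]$; basic open sets are $\{[s,x]:x\in U\}$, $U\subseteq D_{s^*s}$ open. Tight filters. A filter is a nonempty $\eta\subseteq\mathcal{E}$ not containing the empty map $0$, upward closed and closed under products; the set of filters has the topology with basis $\{\eta: X\subseteq\eta,\ Y\cap\eta=\emptyset\}$, $X,Y\subset\mathcal{E}$ finite; $\hat{\mathcal{E}}_{tight}$ is the closure of the set of ultrafilters (maximal filters). $s\in\mathcal{S}_\Lambda$ acts on $D_{s^*s}=\{\eta\in\hat{\mathcal{E}}_{tight}:s^*s\in\eta\}$ by $s\cdot\eta=\{f\in\mathcal{E}: ses^*\le f\text{ for some }e\in\eta\}$. $\mathcal{G}_{tight}(\mathcal{S}_\Lambda):=\mathcal{S}_\Lambda\rtimes\hat{\mathcal{E}}_{tight}$. Path space. $\Lambda^*$ is the set of nonempty $F\subseteq\Lambda$ that are hereditary ($\alpha\le\beta\in F\Rightarrow\alpha\in F$) and directed (any two elements have an upper bound in $F$), with the topology with basis $\{F\in\Lambda^*: X\subseteq F,\ Y\cap F=\emptyset\}$, $X,Y\subset\Lambda$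 finite. $C\in\Lambda^*$ is tight if for every $\alpha\in C$, every finite $\{\beta_1,\dots,\beta_n\}\subset\Lambda$ disjoint from $C$, and every finite $Z\subseteq\alpha\Lambda\setminus\bigcup_i\beta_i\Lambda$ such that each $\gamma\in\alpha\Lambda\setminus\bigcup_i\beta_i\Lambda$ satisfies $\gamma\Cap z$ for some $z\in Z$, one has $C\cap Z\neq\emptyset$. $\Lambda_{tight}$ is the set of tight elements, with the subspace topology. If $\beta\in F\in\Lambda^*$ and $s(\alpha)=s(\beta)$, then $\tau^\alpha\sigma^\beta\cdot F=\bigcup_{\gamma\in F,\ \beta\le\gamma}[\alpha\sigma^\beta(\gamma)]$; for $s=\bigvee_i\tau^{\alpha_i}\sigma^{\beta_i}$ the domain is $\{F:\beta_i\in F\text{ for some }i\}$ and $s\cdot F=\tau^{\alpha_i}\sigma^{\beta_i}\cdot F$ for any $i$ with $\beta_i\in F$. This action restricts to $\Lambda_{tight}$, and $\mathcal{S}_\Lambda\rtimes\Lambda_{tight}$ is its groupoid of germs. *)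

theory Defs
  imports "HOL-Analysis.Analysis"
begin

section \<open>Small categories\<close>

text \<open>
  A small category is identified with its set of morphisms; an object is identified with its
  identity morphism, so source and range are maps from morphisms to (identity) morphisms.
  The composite \<open>cmp L \<alpha> \<beta>\<close> is meaningful only when \<open>src L \<alpha> = rng L \<beta>\<close>.
\<close>

record 'a cat =
  mor :: "'a set"
  src :: "'a \<Rightarrow> 'a"
  rng :: "'a \<Rightarrow> 'a"
  cmp :: "'a \<Rightarrow> 'a \<Rightarrow> 'a"

definition small_category :: "'a cat \<Rightarrow> bool" where
  "small_category L \<longleftrightarrow>
     (\<forall>\<alpha>\<in>mor L. src L \<alpha> \<in> mor L \<and> rng L \<alpha> \<in> mor L
        \<and> src L (src L \<alpha>) = src L \<alpha> \<and> rng L (src L \<alpha>) = src L \<alpha>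
        \<and> src L (rng L \<alpha>) = rng L \<alpha> \<and> rng L (rng L \<alpha>) = rng L \<alpha>
        \<and> cmp L \<alpha> (src L \<alpha>) = \<alpha> \<and> cmp L (rng L \<alpha>) \<alpha> = \<alpha>) \<and>
     (\<forall>\<alpha>\<in>mor L. \<forall>\<beta>\<in>mor L. src L \<alpha> = rng L \<beta> \<longrightarrow>
        cmp L \<alpha> \<beta> \<in> mor L \<and> src L (cmp L \<alpha> \<beta>) = src L \<beta> \<and> rng L (cmp L \<alpha> \<beta>) = rng L \<alpha>) \<and>
     (\<forall>\<alpha>\<in>mor L. \<forall>\<beta>\<in>mor L. \<forall>\<gamma>\<in>mor L. src L \<alpha> = rng L \<beta> \<longrightarrow> src L \<beta> = rng L \<gamma> \<longrightarrow>
        cmp L (cmp L \<alpha> \<beta>) \<gamma> = cmp L \<alpha> (cmp L \<beta> \<gamma>))"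

definition left_cancellative :: "'a cat \<Rightarrow> bool" where
  "left_cancellative L \<longleftrightarrow>
     (\<forall>\<alpha>\<in>mor L. \<forall>\<beta>\<in>mor L. \<forall>\<gamma>\<in>mor L. src L \<alpha> = rng L \<beta> \<longrightarrow> src L \<alpha> = rng L \<gamma> \<longrightarrow>
        cmp L \<alpha> \<beta> = cmp L \<alpha> \<gamma> \<longrightarrow> \<beta> = \<gamma>)"

text \<open>The right ideal \<open>\<alpha>\<Lambda>\<close>.\<close>

definition ideal_of :: "'a cat \<Rightarrow> 'a \<Rightarrow> 'a set" where
  "ideal_of L \<alpha> = {cmp L \<alpha> \<beta> | \<beta>. \<beta> \<in> mor L \<and> rng L \<beta> = src L \<alpha>}"

definition finitely_aligned :: "'a cat \<Rightarrow> bool" where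
  "finitely_aligned L \<longleftrightarrow>
     (\<forall>\<alpha>\<in>mor L. \<forall>\<beta>\<in>mor L. \<exists>\<Gamma>. finite \<Gamma> \<and> \<Gamma> \<subseteq> mor L \<and>
        ideal_of L \<alpha> \<inter> ideal_of L \<beta> = (\<Union>\<gamma>\<in>\<Gamma>. ideal_of L \<gamma>))"

definition path_le :: "'a cat \<Rightarrow> 'a \<Rightarrow> 'a \<Rightarrow> bool" where
  "path_le L \<alpha> \<beta> \<longleftrightarrow> \<beta> \<in> ideal_of L \<alpha>"

definition segments :: "'a cat \<Rightarrow> 'a \<Rightarrow> 'a set" where
  "segments L \<beta> = {\<alpha> \<in> mor L. path_le L \<alpha> \<beta>}"

definition meets :: "'a cat \<Rightarrow> 'a \<Rightarrow> 'a \<Rightarrow> bool" where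
  "meets L \<alpha> \<beta> \<longleftrightarrow> ideal_of L \<alpha> \<inter> ideal_of L \<beta> \<noteq> {}"


section \<open>The inverse semigroup of a left cancellative small category\<close>

text \<open>
  Partial bijections are partial functions \<open>'a \<rightharpoonup> 'a\<close>; the product \<open>st\<close> is \<open>s \<circ>\<^sub>m t\<close>
  (first \<open>t\<close>, then \<open>s\<close>), and \<open>0\<close> is \<open>Map.empty\<close>.
\<close>

definition pinverse :: "('a \<rightharpoonup> 'a) \<Rightarrow> ('a \<rightharpoonup> 'a)" where
  "pinverse f = (\<lambda>y. if \<exists>x. f x = Some y then Some (THE x. f x = Some y) else None)"

definition tau :: "'a cat \<Rightarrow> 'a \<Rightarrow> ('a \<rightharpoonup> 'a)" where
  "tau L \<alpha> = (\<lambda>\<beta>. if \<beta> \<in> ideal_of L (src L \<alpha>) then Some (cmp L \<alpha> \<beta>) else None)"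

definition sigma :: "'a cat \<Rightarrow> 'a \<Rightarrow> ('a \<rightharpoonup> 'a)" where
  "sigma L \<alpha> = pinverse (tau L \<alpha>)"

inductive_set cat_isg :: "'a cat \<Rightarrow> ('a \<rightharpoonup> 'a) set" for L :: "'a cat" where
  tau: "\<alpha> \<in> mor L \<Longrightarrow> tau L \<alpha> \<in> cat_isg L"
| sigma: "\<alpha> \<in> mor L \<Longrightarrow> sigma L \<alpha> \<in> cat_isg L"
| mult: "s \<in> cat_isg L \<Longrightarrow> t \<in> cat_isg L \<Longrightarrow> s \<circ>\<^sub>m t \<in> cat_isg L"
| inverse: "s \<in> cat_isg L \<Longrightarrow> pinverse s \<in> cat_isg L"

definition cat_idem :: "'a cat \<Rightarrow> ('a \<rightharpoonup> 'a) set" where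
  "cat_idem L = {e \<in> cat_isg L. e \<circ>\<^sub>m e = e}"

definition idem_le :: "('a \<rightharpoonup> 'a) \<Rightarrow> ('a \<rightharpoonup> 'a) \<Rightarrow> bool" where
  "idem_le e f \<longleftrightarrow> e = e \<circ>\<^sub>m f"

text \<open>
  \<open>join_rep L s D\<close>: the finite set \<open>D = {(\<alpha>\<^sub>1,\<beta>\<^sub>1),\<dots>,(\<alpha>\<^sub>n,\<beta>\<^sub>n)}\<close> presents \<open>s\<close> as the join
  (union of partial maps) of the \<open>\<tau>\<^sup>\<alpha>\<^sup>i\<sigma>\<^sup>\<beta>\<^sup>i\<close>.
\<close>

definition join_rep :: "'a cat \<Rightarrow> ('a \<rightharpoonup> 'a) \<Rightarrow> ('a \<times> 'a) set \<Rightarrow> bool" where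
  "join_rep L s D \<longleftrightarrow> finite D \<and>
     (\<forall>(\<alpha>, \<beta>)\<in>D. \<alpha> \<in> mor L \<and> \<beta> \<in> mor L \<and> src L \<alpha> = src L \<beta>) \<and>
     Map.graph s = (\<Union>(\<alpha>, \<beta>)\<in>D. Map.graph (tau L \<alpha> \<circ>\<^sub>m sigma L \<beta>))"


section \<open>Topological groupoids and groupoids of germs\<close>

text \<open>
  A topological groupoid is given by its space of arrows (the set of arrows being the
  \<open>topspace\<close>), its unit space, and its structure maps; \<open>gmul G g h\<close> is meaningful only when
  \<open>gdom G g = gran G h\<close>.
\<close>

record ('g, 'x) top_groupoid =
  arrows :: "'g topology"
  units :: "'x topology"
  gdom :: "'g \<Rightarrow> 'x"
  gran :: "'g \<Rightarrow> 'x"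
  gmul :: "'g \<Rightarrow> 'g \<Rightarrow> 'g"
  ginv :: "'g \<Rightarrow> 'g"

definition top_groupoid_iso ::
    "('g, 'x) top_groupoid \<Rightarrow> ('h, 'y) top_groupoid \<Rightarrow> ('g \<Rightarrow> 'h) \<Rightarrow> ('x \<Rightarrow> 'y) \<Rightarrow> bool" where
  "top_groupoid_iso G H \<phi> \<phi>\<^sub>0 \<longleftrightarrow>
     homeomorphic_map (arrows G) (arrows H) \<phi> \<and>
     homeomorphic_map (units G) (units H) \<phi>\<^sub>0 \<and>
     (\<forall>g\<in>topspace (arrows G).
        gdom H (\<phi> g) = \<phi>\<^sub>0 (gdom G g) \<and> gran H (\<phi> g) = \<phi>\<^sub>0 (gran G g) \<and>
        ginv H (\<phi> g) = \<phi> (ginv G g)) \<and>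
     (\<forall>g\<in>topspace (arrows G). \<forall>h\<in>topspace (arrows G). gdom G g = gran G h \<longrightarrow>
        gmul H (\<phi> g) (\<phi> h) = \<phi> (gmul G g h))"

definition topologically_isomorphic ::
    "('g, 'x) top_groupoid \<Rightarrow> ('h, 'y) top_groupoid \<Rightarrow> bool" where
  "topologically_isomorphic G H \<longleftrightarrow> (\<exists>\<phi> \<phi>\<^sub>0. top_groupoid_iso G H \<phi> \<phi>\<^sub>0)"

text \<open>
  The data of an action of an inverse semigroup on a space by partial homeomorphisms.
  \<open>adom A s\<close> is the domain of \<open>s\<cdot>\<close>, that is \<open>D\<close> at \<open>s\<^sup>*s\<close>; in particular \<open>adom A e\<close> is \<open>D\<close> at \<open>e\<close>
  for idempotent \<open>e\<close>.
\<close>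

record ('s, 'x) isg_action =
  isg :: "'s set"
  imul :: "'s \<Rightarrow> 's \<Rightarrow> 's"
  istar :: "'s \<Rightarrow> 's"
  space_of :: "'x topology"
  adom :: "'s \<Rightarrow> 'x set"
  act :: "'s \<Rightarrow> 'x \<Rightarrow> 'x"

definition germ_rel :: "('s, 'x) isg_action \<Rightarrow> (('s \<times> 'x) \<times> ('s \<times> 'x)) set" where
  "germ_rel A = {((s, x), (t, y)). s \<in> isg A \<and> t \<in> isg A \<and> x \<in> adom A s \<and> y \<in> adom A t \<and> x = y \<and>
     (\<exists>e\<in>isg A. imul A e e = e \<and> x \<in> adom A e \<and> imul A s e = imul A t e)}"

definition germ :: "('s, 'x) isg_action \<Rightarrow> 's \<Rightarrow> 'x \<Rightarrow> ('s \<times> 'x) set" where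
  "germ A s x = germ_rel A `` {(s, x)}"

text \<open>
  The structure maps are given on representatives, the definite descriptions
  expressing independence of the chosen representatives.
\<close>

definition germ_groupoid :: "('s, 'x) isg_action \<Rightarrow> (('s \<times> 'x) set, 'x) top_groupoid" where
  "germ_groupoid A = \<lparr>
     arrows = topology_generated_by
       {germ A s ` U | s U. s \<in> isg A \<and> openin (space_of A) U \<and> U \<subseteq> adom A s},
     units = space_of A,
     gdom = (\<lambda>g. THE x. \<exists>s. (s, x) \<in> g),
     gran = (\<lambda>g. THE y. \<exists>s x. (s, x) \<in> g \<and> y = act A s x),
     gmul = (\<lambda>g h. THE k. \<exists>s t x. (s, act A t x) \<in> g \<and> (t, x) \<in> h \<and> k = germ A (imul A s t) x),
     ginv = (\<lambda>g. THE k. \<exists>s x. (s, x) \<in> g \<and> k = germ A (istar A s) (act A s x)) \<rparr>"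


section \<open>Tight filters and the tight groupoid\<close>

definition is_filter :: "'a cat \<Rightarrow> ('a \<rightharpoonup> 'a) set \<Rightarrow> bool" where
  "is_filter L \<eta> \<longleftrightarrow> \<eta> \<noteq> {} \<and> \<eta> \<subseteq> cat_idem L \<and> Map.empty \<notin> \<eta> \<and>
     (\<forall>e\<in>\<eta>. \<forall>f\<in>cat_idem L. idem_le e f \<longrightarrow> f \<in> \<eta>) \<and>
     (\<forall>e\<in>\<eta>. \<forall>f\<in>\<eta>. e \<circ>\<^sub>m f \<in> \<eta>)"

definition is_ultrafilter :: "'a cat \<Rightarrow> ('a \<rightharpoonup> 'a) set \<Rightarrow> bool" where
  "is_ultrafilter L \<eta> \<longleftrightarrow> is_filter L \<eta> \<and> (\<forall>\<xi>. is_filter L \<xi> \<longrightarrow> \<eta> \<subseteq> \<xi> \<longrightarrow> \<xi> = \<eta>)"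

definition filter_space :: "'a cat \<Rightarrow> ('a \<rightharpoonup> 'a) set topology" where
  "filter_space L = topology_generated_by
     {{\<eta>. is_filter L \<eta> \<and> X \<subseteq> \<eta> \<and> Y \<inter> \<eta> = {}} | X Y.
        finite X \<and> X \<subseteq> cat_idem L \<and> finite Y \<and> Y \<subseteq> cat_idem L}"

definition tight_filters :: "'a cat \<Rightarrow> ('a \<rightharpoonup> 'a) set set" where
  "tight_filters L = filter_space L closure_of {\<eta>. is_ultrafilter L \<eta>}"

definition filter_action :: "'a cat \<Rightarrow> ('a \<rightharpoonup> 'a, ('a \<rightharpoonup> 'a) set) isg_action" where
  "filter_action L = \<lparr>
     isg = cat_isg L,
     imul = (\<circ>\<^sub>m),
     istar = pinverse,
     space_of = subtopology (filter_space L) (tight_filters L),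
     adom = (\<lambda>s. {\<eta> \<in> tight_filters L. pinverse s \<circ>\<^sub>m s \<in> \<eta>}),
     act = (\<lambda>s \<eta>. {f \<in> cat_idem L. \<exists>e\<in>\<eta>. idem_le (s \<circ>\<^sub>m e \<circ>\<^sub>m pinverse s) f}) \<rparr>"

definition tight_groupoid ::
    "'a cat \<Rightarrow> ((('a \<rightharpoonup> 'a) \<times> ('a \<rightharpoonup> 'a) set) set, ('a \<rightharpoonup> 'a) set) top_groupoid" where
  "tight_groupoid L = germ_groupoid (filter_action L)"


section \<open>The path space and its tight part\<close>

definition path_space_set :: "'a cat \<Rightarrow> 'a set set" where
  "path_space_set L = {F. F \<noteq> {} \<and> F \<subseteq> mor L \<and>
     (\<forall>\<beta>\<in>F. \<forall>\<alpha>\<in>mor L. path_le L \<alpha> \<beta> \<longrightarrow> \<alpha> \<in> F) \<and>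
     (\<forall>\<alpha>\<in>F. \<forall>\<beta>\<in>F. \<exists>\<gamma>\<in>F. path_le L \<alpha> \<gamma> \<and> path_le L \<beta> \<gamma>)}"

definition path_space :: "'a cat \<Rightarrow> 'a set topology" where
  "path_space L = topology_generated_by
     {{F \<in> path_space_set L. X \<subseteq> F \<and> Y \<inter> F = {}} | X Y.
        finite X \<and> X \<subseteq> mor L \<and> finite Y \<and> Y \<subseteq> mor L}"

definition tight_paths :: "'a cat \<Rightarrow> 'a set set" where
  "tight_paths L = {C \<in> path_space_set L.
     \<forall>\<alpha>\<in>C. \<forall>B Z. finite B \<longrightarrow> B \<subseteq> mor L \<longrightarrow> B \<inter> C = {} \<longrightarrow>
       finite Z \<longrightarrow> Z \<subseteq> ideal_of L \<alpha> - (\<Union>\<beta>\<in>B. ideal_of L \<beta>) \<longrightarrow>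
       (\<forall>\<gamma>\<in>ideal_of L \<alpha> - (\<Union>\<beta>\<in>B. ideal_of L \<beta>). \<exists>z\<in>Z. meets L \<gamma> z) \<longrightarrow>
       C \<inter> Z \<noteq> {}}"

definition basic_path_act :: "'a cat \<Rightarrow> 'a \<Rightarrow> 'a \<Rightarrow> 'a set \<Rightarrow> 'a set" where
  "basic_path_act L \<alpha> \<beta> F =
     (\<Union>\<gamma>\<in>{\<gamma>\<in>F. path_le L \<beta> \<gamma>}. segments L (cmp L \<alpha> (the (sigma L \<beta> \<gamma>))))"

definition path_action :: "'a cat \<Rightarrow> ('a \<rightharpoonup> 'a, 'a set) isg_action" where
  "path_action L = \<lparr>
     isg = cat_isg L,
     imul = (\<circ>\<^sub>m),
     istar = pinverse,
     space_of = subtopology (path_space L) (tight_paths L),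
     adom = (\<lambda>s. {F \<in> tight_paths L. \<exists>D. join_rep L s D \<and> (\<exists>(\<alpha>, \<beta>)\<in>D. \<beta> \<in> F)}),
     act = (\<lambda>s F. THE F'. \<exists>D. join_rep L s D \<and>
        (\<exists>(\<alpha>, \<beta>)\<in>D. \<beta> \<in> F \<and> F' = basic_path_act L \<alpha> \<beta> F)) \<rparr>"

definition path_groupoid ::
    "'a cat \<Rightarrow> ((('a \<rightharpoonup> 'a) \<times> 'a set) set, 'a set) top_groupoid" where
  "path_groupoid L = germ_groupoid (path_action L)"

end

theory Submission
  imports Defs
begin

text \<open>
  The idempotents of \<open>\<S>\<^sub>\<Lambda>\<close> are the identities of finite unions of ideals \<open>\<gamma>\<Lambda>\<close>. An ultrafilter
  containing such a union contains one of the \<open>\<gamma>\<Lambda>\<close>, and this property passes to the closure;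
  hence a tight filter \<open>\<eta>\<close> is determined by the path \<open>F = {\<alpha>. \<alpha>\<Lambda> \<in> \<eta>}\<close>, and \<open>\<eta>\<close> consists of
  the idempotents whose domain meets \<open>F\<close>. The filter is a limit of ultrafilters iff \<open>F\<close> is tight.
  The bijection is an equivariant homeomorphism, since \<open>s \<cdot> F\<close> is the set of all initial segments
  of elements of \<open>s (F \<inter> dom s)\<close>; so it induces an isomorphism of the groupoids of germs. The germs
  at a path are transparent: \<open>[s, F] = [t, F]\<close> iff \<open>s\<close> and \<open>t\<close> agree at some \<open>\<gamma> \<in> F\<close>.
\<close>

section \<open>Germ groupoids\<close>

text \<open>The structure maps of a groupoid of germs are definite descriptions, so independence of
  representatives has to come before any computation. It is proved for paths only, where one common
  value decides equality of germs, and is pulled back to filters along the injective transport of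
  germs.

  Two properties of semigroup elements survive products and inverses: \<open>s\<close> commutes with
  right multiplication, so that its value at \<gamma> fixes it on \<open>\<gamma>\<Lambda>\<close>,
  and its domain is a finite union of ideals. Finite alignment enters through the second, since the
  domain of a product involves an intersection. Joins serve to decode the given form of the path
  action.

  Finite generation has a second use: that a filter contains a union but none of its ideals is a
  basic open condition, hence can be tested on an ultrafilter. An ultrafilter omits an idempotent
  only if it contains a disjoint one, and such disjointness is what exhaustive sets in the
  definition of tightness rule out. That the action preserves tightness is proved on the way, by
  pulling exhaustive sets back along \<open>s\<close>.\<close>

lemma homeomorphic_map_topology_generated_by:
  assumes inj: "inj_on f (\<Union>\<S>)"
  shows "homeomorphic_map (topology_generated_by \<S>) (topology_generated_by ((`) f ` \<S>)) f"
proof -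
  let ?g = "inv_into (\<Union>\<S>) f"
  have gf: "?g (f x) = x" if "x \<in> U" "U \<in> \<S>" for x U
    using inv_into_f_f[OF inj] that by blast
  have "homeomorphic_maps (topology_generated_by \<S>) (topology_generated_by ((`) f ` \<S>)) f ?g"
    unfolding homeomorphic_maps_def continuous_on_generated_topo_iff
  proof (intro conjI allI impI ballI)
    fix V assume "V \<in> (`) f ` \<S>"
    then obtain U where U: "U \<in> \<S>" "V = f ` U" by blast
    \<comment> \<open>Injectivity on the whole union, and not only on each member of
      \<open>\<S>\<close>, makes the preimage of the image \<open>V\<close> exactly
      \<open>U\<close>.\<close>
    have "f -` V \<inter> topspace (topology_generated_by \<S>) = U"
      using U inj unfolding inj_on_def by fastforce
    then show "openin (topology_generated_by \<S>) (f -` V \<inter> topspace (topology_generated_by \<S>))"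
      using U by (simp add: topology_generated_by_Basis)
  next
    show "f ` topspace (topology_generated_by \<S>) \<subseteq> \<Union> ((`) f ` \<S>)" by auto
  next
    fix U assume U: "U \<in> \<S>"
    have "?g -` U \<inter> topspace (topology_generated_by ((`) f ` \<S>)) = f ` U"
      using U gf by force
    then show "openin (topology_generated_by ((`) f ` \<S>))
        (?g -` U \<inter> topspace (topology_generated_by ((`) f ` \<S>)))"
      using U by (simp add: topology_generated_by_Basis)
  next
    show "?g ` topspace (topology_generated_by ((`) f ` \<S>)) \<subseteq> \<Union> \<S>"
      using gf by auto
  next
    fix x assume "x \<in> topspace (topology_generated_by \<S>)"
    then show "?g (f x) = x" using gf by auto
  next
    fix y assume "y \<in> topspace (topology_generated_by ((`) f ` \<S>))"
    then show "f (?g y) = y" using gf by auto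
  qed
  then show ?thesis by (meson homeomorphic_map_maps)
qed

text \<open>Binary intersections are enough: the space of a generated topology is the union of the
  family, so the empty intersection is not an extra generator. This lets closures be tested on basic
  sets.\<close>

lemma topology_generated_by_local_base:
  assumes "openin (topology_generated_by \<B>) T" "x \<in> T"
    and inter: "\<And>U V. U \<in> \<B> \<Longrightarrow> V \<in> \<B> \<Longrightarrow> U \<inter> V \<in> \<B>"
  shows "\<exists>U\<in>\<B>. x \<in> U \<and> U \<subseteq> T"
proof -
  have "generate_topology_on \<B> T" using assms(1) openin_topology_generated_by by blast
  then show ?thesis using assms(2)
  proof (induction arbitrary: x rule: generate_topology_on.induct)
    case (Int a b)
    then obtain U V where "U \<in> \<B>" "x \<in> U" "U \<subseteq> a" "V \<in> \<B>" "x \<in> V" "V \<subseteq> b" by (meson IntD1 IntD2)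
    then show ?case using inter by (meson Int_iff Int_mono)
  next
    case (UN K)
    then show ?case by (meson Union_iff Union_upper subset_trans)
  qed auto
qed

text \<open>The work is split between the two sides: existence is checked at the source, uniqueness
  at the target, and injectivity of \<open>f\<close> on \<open>K\<close> pulls uniqueness back. A
  structure map thus needs to be shown well defined in one groupoid only.\<close>

lemma The_transport:
  assumes "P k" and "\<And>k. P k \<Longrightarrow> k \<in> K \<and> Q (f k)" and "inj_on f K"
    and "\<And>x y. Q x \<Longrightarrow> Q y \<Longrightarrow> x = y"
  shows "(THE x. Q x) = f (THE k. P k)"
proof -
  have "(THE k. P k) = k"
    using assms by (intro the_equality) (auto simp: inj_on_def)
  moreover have "(THE x. Q x) = f k"
    using assms by (intro the_equality) auto
  ultimately show ?thesis by simp
qed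

text \<open>What the definite descriptions in \<open>germ_groupoid\<close> need in order to be
  meaningful. Symmetry is derived, the equation in \<open>germ_rel\<close> being symmetric. In
  \<open>mul_cong\<close> both left factors sit at \<open>act B t y\<close>; that \<open>t'\<close>
  carries \<open>y\<close> to the same point is the content of \<open>act_cong\<close>.\<close>

locale germ_action =
  fixes B :: "('s, 'y) isg_action"
  assumes refl: "s \<in> isg B \<Longrightarrow> y \<in> adom B s \<Longrightarrow> ((s, y), (s, y)) \<in> germ_rel B"
    and trans: "((s, y), (t, y)) \<in> germ_rel B \<Longrightarrow> ((t, y), (u, y)) \<in> germ_rel B
      \<Longrightarrow> ((s, y), (u, y)) \<in> germ_rel B"
    and act_cong: "((s, y), (t, y)) \<in> germ_rel B \<Longrightarrow> act B s y = act B t y"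
    and mul_cong: "((s, act B t y), (s', act B t y)) \<in> germ_rel B \<Longrightarrow> ((t, y), (t', y)) \<in> germ_rel B
      \<Longrightarrow> germ B (imul B s t) y = germ B (imul B s' t') y"
    and inv_cong: "((s, y), (t, y)) \<in> germ_rel B
      \<Longrightarrow> germ B (istar B s) (act B s y) = germ B (istar B t) (act B t y)"
begin

lemma sym: "((s, y), (t, y)) \<in> germ_rel B \<Longrightarrow> ((t, y), (s, y)) \<in> germ_rel B"
  unfolding germ_rel_def by fastforce

lemma germ_point: "(s, y) \<in> germ B s0 y0 \<Longrightarrow> y = y0"
  unfolding germ_def germ_rel_def by auto

lemma germ_rel_of_germ:
  assumes "(s, y) \<in> germ B s0 y0" "(t, y) \<in> germ B s0 y0"
  shows "((s, y), (t, y)) \<in> germ_rel B"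
  using assms germ_point[OF assms(1)] sym trans unfolding germ_def by blast

end

text \<open>An equivariant homeomorphism of unit spaces relabels the points in the representatives
  of a germ. Since it identifies domains, also those of idempotents, the two germ relations
  correspond; independence of representatives is required of \<open>B\<close> and pulled back to
  \<open>A\<close>.\<close>

theorem germ_groupoids_isomorphic:
  fixes A :: "('s, 'x) isg_action" and B :: "('s, 'y) isg_action" and f :: "'x \<Rightarrow> 'y"
  assumes isg: "isg A = isg B" and imul: "imul A = imul B" and istar: "istar A = istar B"
    and homeo: "homeomorphic_map (space_of A) (space_of B) f"
    and domA: "\<And>s. s \<in> isg B \<Longrightarrow> adom A s \<subseteq> topspace (space_of A)"
    and domB: "\<And>s. s \<in> isg B \<Longrightarrow> adom B s \<subseteq> topspace (space_of B)"
    and dom: "\<And>s x. s \<in> isg B \<Longrightarrow> x \<in> topspace (space_of A) \<Longrightarrow> f x \<in> adom B s \<longleftrightarrow> x \<in> adom A s"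
    and act_in: "\<And>s x. s \<in> isg B \<Longrightarrow> x \<in> adom A s \<Longrightarrow> act A s x \<in> topspace (space_of A)"
    and act: "\<And>s x. s \<in> isg B \<Longrightarrow> x \<in> adom A s \<Longrightarrow> act B s (f x) = f (act A s x)"
    and B: "germ_action B"
  shows "topologically_isomorphic (germ_groupoid A) (germ_groupoid B)"
proof -
  interpret B: germ_action B by (rule B)
  define X where "X = topspace (space_of A)"
  have inj: "inj_on f X"
    using homeo by (simp add: X_def homeomorphic_eq_everything_map)
  have fX: "f ` X = topspace (space_of B)"
    using homeo by (simp add: X_def homeomorphic_eq_everything_map)
  define \<phi> :: "('s \<times> 'x) set \<Rightarrow> ('s \<times> 'y) set" where "\<phi> = (`) (map_prod id f)"
  \<comment> \<open>A set on which \<open>\<phi>\<close> is injective and which contains every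
    \<open>germ A s x\<close>, also the empty one at a point outside the domain of \<open>s\<close>.
    This avoids case distinctions when \<open>The_transport\<close> is applied.\<close>
  define K where "K = Pow (isg B \<times> X)"
  have inj\<phi>: "inj_on \<phi> K"
    unfolding \<phi>_def K_def by (intro inj_on_image_Pow map_prod_inj_on inj) auto
  have rel: "((s, f x), (t, f x)) \<in> germ_rel B \<longleftrightarrow> ((s, x), (t, x)) \<in> germ_rel A" if "x \<in> X" for s t x
    using dom that unfolding germ_rel_def X_def isg imul by auto
  have relA: "x \<in> X \<and> y = x \<and> s \<in> isg B \<and> t \<in> isg B \<and> x \<in> adom A s \<and> x \<in> adom A t"
    if "((s, x), (t, y)) \<in> germ_rel A" for s t x y
    using that domA unfolding germ_rel_def isg X_def by auto
  have germ\<phi>: "\<phi> (germ A s x) = germ B s (f x)" if x: "x \<in> X" for s x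
  proof (intro set_eqI iffI)
    fix p assume "p \<in> \<phi> (germ A s x)"
    then show "p \<in> germ B s (f x)"
      using rel[OF x] relA unfolding \<phi>_def germ_def by fastforce
  next
    fix p assume "p \<in> germ B s (f x)"
    then obtain t where "p = (t, f x)" "((s, f x), (t, f x)) \<in> germ_rel B"
      unfolding germ_def germ_rel_def by auto
    then have "p = map_prod id f (t, x)" "(t, x) \<in> germ A s x"
      using rel[OF x] unfolding germ_def by auto
    then show "p \<in> \<phi> (germ A s x)" unfolding \<phi>_def by blast
  qed
  have germK: "germ A s x \<in> K" for s x
    using relA unfolding K_def germ_def by auto
  define basis where "basis = {germ A s ` U | s U. s \<in> isg A \<and> openin (space_of A) U \<and> U \<subseteq> adom A s}"
  have basis_sub: "U \<subseteq> X" if "openin (space_of A) U" for U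
    using that openin_subset X_def by blast
  have arrowsE: "\<exists>s x. g = germ A s x \<and> s \<in> isg B \<and> x \<in> adom A s \<and> x \<in> X"
    if "g \<in> topspace (arrows (germ_groupoid A))" for g
  proof -
    have "g \<in> \<Union>basis" using that by (simp add: germ_groupoid_def basis_def)
    then obtain s U x where "s \<in> isg A" "U \<subseteq> adom A s" "x \<in> U" "g = germ A s x"
      unfolding basis_def by auto
    then show ?thesis using domA isg X_def by blast
  qed
  have arrows: "homeomorphic_map (arrows (germ_groupoid A)) (arrows (germ_groupoid B)) \<phi>"
  proof -
    have "\<Union>basis \<subseteq> K" unfolding basis_def using germK by auto
    then have injb: "inj_on \<phi> (\<Union>basis)" by (rule inj_on_subset[OF inj\<phi>])
    have "(`) \<phi> ` basis = {germ B s ` V | s V. s \<in> isg B \<and> openin (space_of B) V \<and> V \<subseteq> adom B s}"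
    proof (intro set_eqI iffI)
      fix W assume "W \<in> (`) \<phi> ` basis"
      then obtain s U where s: "s \<in> isg B" "openin (space_of A) U" "U \<subseteq> adom A s"
        and W: "W = \<phi> ` germ A s ` U"
        unfolding basis_def isg by auto
      have UX: "U \<subseteq> X" using basis_sub s by blast
      have "W = germ B s ` (f ` U)"
        unfolding W image_image using germ\<phi> UX by (intro image_cong) auto
      moreover have "openin (space_of B) (f ` U)"
        using homeo s(2) UX X_def homeomorphic_map_openness by blast
      moreover have "f ` U \<subseteq> adom B s" using dom s UX X_def by blast
      ultimately show "W \<in> {germ B s ` V | s V. s \<in> isg B \<and> openin (space_of B) V \<and> V \<subseteq> adom B s}"
        using s by blast
    next
      fix W assume "W \<in> {germ B s ` V | s V. s \<in> isg B \<and> openin (space_of B) V \<and> V \<subseteq> adom B s}"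
      then obtain s V where s: "s \<in> isg B" "openin (space_of B) V" "V \<subseteq> adom B s"
        and W: "W = germ B s ` V" by auto
      define U where "U = {x \<in> X. f x \<in> V}"
      have UX: "U \<subseteq> X" by (auto simp: U_def)
      have fU: "f ` U = V"
        using s(3) domB[OF s(1)] unfolding fX[symmetric] U_def by blast
      have "openin (space_of A) U"
        using homeo s(2) UX fU X_def homeomorphic_map_openness by metis
      moreover have "U \<subseteq> adom A s" using dom s UX X_def U_def by blast
      moreover have "W = \<phi> ` germ A s ` U"
        unfolding W fU[symmetric] image_image using germ\<phi> UX by (intro image_cong) auto
      ultimately show "W \<in> (`) \<phi> ` basis"
        using s isg unfolding basis_def by blast
    qed
    then show ?thesis
      using homeomorphic_map_topology_generated_by[OF injb]
      unfolding germ_groupoid_def basis_def[symmetric] by simp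
  qed
  have memB: "(s, f x) \<in> \<phi> g" if "(s, x) \<in> g" for s x g
    using that unfolding \<phi>_def by force
  have relB: "((s, y), (t, y)) \<in> germ_rel B"
    if "x \<in> X" "(s, y) \<in> \<phi> (germ A s0 x)" "(t, y) \<in> \<phi> (germ A s0 x)" for s t y s0 x
    using that germ\<phi> B.germ_rel_of_germ by metis
  have germ_ptB: "y = f x" if "x \<in> X" "(s, y) \<in> \<phi> (germ A s0 x)" for s y s0 x
    using that germ\<phi> B.germ_point by metis
  have refl: "(s, x) \<in> germ A s x" if "s \<in> isg B" "x \<in> adom A s" "x \<in> X" for s x
    using B.refl[OF that(1), of "f x"] rel[OF that(3)] dom that unfolding germ_def X_def by blast
  have germE: "x = x0 \<and> s \<in> isg B \<and> x \<in> adom A s \<and> x \<in> X" if "(s, x) \<in> germ A s0 x0" for s x s0 x0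
    using that relA unfolding germ_def by blast
  have gdomA: "gdom (germ_groupoid A) (germ A s x) = x"
    if "s \<in> isg B" "x \<in> adom A s" "x \<in> X" for s x
    unfolding germ_groupoid_def using refl[OF that] germE by (auto intro!: the_equality)
  have gdom: "gdom (germ_groupoid B) (\<phi> (germ A s x)) = f x"
    if "s \<in> isg B" "x \<in> adom A s" "x \<in> X" for s x
    unfolding germ_groupoid_def top_groupoid.simps
  proof (rule the_equality)
    show "\<exists>t. (t, f x) \<in> \<phi> (germ A s x)" using memB[OF refl[OF that]] by blast
    show "y = f x" if "\<exists>t. (t, y) \<in> \<phi> (germ A s x)" for y
      using that germ_ptB[OF \<open>x \<in> X\<close>] by blast
  qed
  have gran: "gran (germ_groupoid B) (\<phi> (germ A s x)) = f (gran (germ_groupoid A) (germ A s x))"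
    if sx: "s \<in> isg B" "x \<in> adom A s" "x \<in> X" for s x
    unfolding germ_groupoid_def top_groupoid.simps
  proof (rule The_transport[where K = X])
    show "\<exists>t z. (t, z) \<in> germ A s x \<and> act A s x = act A t z" using refl[OF sx] by blast
    fix k assume "\<exists>t z. (t, z) \<in> germ A s x \<and> k = act A t z"
    then obtain t z where t: "(t, z) \<in> germ A s x" "k = act A t z" by blast
    then show "k \<in> X \<and> (\<exists>t z. (t, z) \<in> \<phi> (germ A s x) \<and> f k = act B t z)"
      using memB[OF t(1)] germE[OF t(1)] act act_in unfolding X_def by metis
  next
    fix y y'
    assume "\<exists>t z. (t, z) \<in> \<phi> (germ A s x) \<and> y = act B t z"
      "\<exists>t z. (t, z) \<in> \<phi> (germ A s x) \<and> y' = act B t z"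
    then show "y = y'" using germ_ptB[OF sx(3)] relB[OF sx(3)] B.act_cong by metis
  next
    show "inj_on f X" by (rule inj)
  qed
  \<comment> \<open>The range in \<open>A\<close> is needed by value: it turns composability into
    \<open>x = act A t y\<close>, which brings a composable pair into the form treated in
    \<open>gmul\<close>. Independence of the representative is read off in \<open>B\<close> and
    pulled back by injectivity of \<open>f\<close>.\<close>
  have granA: "gran (germ_groupoid A) (germ A s x) = act A s x"
    if sx: "s \<in> isg B" "x \<in> adom A s" "x \<in> X" for s x
    unfolding germ_groupoid_def top_groupoid.simps
  proof (rule the_equality)
    show "\<exists>t z. (t, z) \<in> germ A s x \<and> act A s x = act A t z" using refl[OF sx] by blast
    fix k assume "\<exists>t z. (t, z) \<in> germ A s x \<and> k = act A t z"
    then obtain t where t: "(t, x) \<in> germ A s x" "k = act A t x" using germE by blast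
    have "act B s (f x) = act B t (f x)"
      using t(1) rel[OF sx(3)] B.act_cong unfolding germ_def by blast
    then show "k = act A s x"
      using act act_in germE[OF t(1)] sx t(2) inj X_def by (metis inj_onD)
  qed
  have ginv: "ginv (germ_groupoid B) (\<phi> (germ A s x)) = \<phi> (ginv (germ_groupoid A) (germ A s x))"
    if sx: "s \<in> isg B" "x \<in> adom A s" "x \<in> X" for s x
    unfolding germ_groupoid_def top_groupoid.simps
  proof (rule The_transport[where K = K])
    show "\<exists>t z. (t, z) \<in> germ A s x \<and> germ A (istar A s) (act A s x) = germ A (istar A t) (act A t z)"
      using refl[OF sx] by blast
    fix k assume "\<exists>t z. (t, z) \<in> germ A s x \<and> k = germ A (istar A t) (act A t z)"
    then obtain t z where t: "(t, z) \<in> germ A s x" "k = germ A (istar A t) (act A t z)" by blast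
    have "\<phi> k = germ B (istar B t) (act B t (f z))"
      using t germE[OF t(1)] germ\<phi> act act_in istar X_def by metis
    then show "k \<in> K \<and> (\<exists>t z. (t, z) \<in> \<phi> (germ A s x) \<and> \<phi> k = germ B (istar B t) (act B t z))"
      using memB[OF t(1)] germK t(2) by blast
  next
    fix y y'
    assume "\<exists>t z. (t, z) \<in> \<phi> (germ A s x) \<and> y = germ B (istar B t) (act B t z)"
      "\<exists>t z. (t, z) \<in> \<phi> (germ A s x) \<and> y' = germ B (istar B t) (act B t z)"
    then show "y = y'" using germ_ptB[OF sx(3)] relB[OF sx(3)] B.inv_cong by metis
  next
    show "inj_on \<phi> K" by (rule inj\<phi>)
  qed
  have gmul: "gmul (germ_groupoid B) (\<phi> (germ A s (act A t x))) (\<phi> (germ A t x))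
      = \<phi> (gmul (germ_groupoid A) (germ A s (act A t x)) (germ A t x))"
    if tx: "t \<in> isg B" "x \<in> adom A t" "x \<in> X"
      and sx: "s \<in> isg B" "act A t x \<in> adom A s" "act A t x \<in> X" for s t x
    unfolding germ_groupoid_def top_groupoid.simps
  proof (rule The_transport[where K = K])
    let ?g = "germ A s (act A t x)" and ?h = "germ A t x"
    show "\<exists>u v z. (u, act A v z) \<in> ?g \<and> (v, z) \<in> ?h \<and> germ A (imul A s t) x = germ A (imul A u v) z"
      using refl[OF sx] refl[OF tx] by blast
    fix k assume "\<exists>u v z. (u, act A v z) \<in> ?g \<and> (v, z) \<in> ?h \<and> k = germ A (imul A u v) z"
    then obtain u v z where t: "(u, act A v z) \<in> ?g" "(v, z) \<in> ?h" "k = germ A (imul A u v) z"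
      by blast
    have "\<phi> k = germ B (imul B u v) (f z)"
      using t germE[OF t(2)] germ\<phi> imul by metis
    moreover have "(u, act B v (f z)) \<in> \<phi> ?g"
      using memB[OF t(1)] act germE[OF t(2)] by metis
    ultimately show "k \<in> K \<and> (\<exists>u v z. (u, act B v z) \<in> \<phi> ?g \<and> (v, z) \<in> \<phi> ?h
        \<and> \<phi> k = germ B (imul B u v) z)"
      using memB[OF t(2)] germK t(3) by blast
  next
    let ?g = "germ A s (act A t x)" and ?h = "germ A t x"
    fix y y'
    assume "\<exists>u v z. (u, act B v z) \<in> \<phi> ?g \<and> (v, z) \<in> \<phi> ?h \<and> y = germ B (imul B u v) z"
      "\<exists>u v z. (u, act B v z) \<in> \<phi> ?g \<and> (v, z) \<in> \<phi> ?h \<and> y' = germ B (imul B u v) z"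
    then obtain u v u' v' where
      1: "(u, act B v (f x)) \<in> \<phi> ?g" "(v, f x) \<in> \<phi> ?h" "y = germ B (imul B u v) (f x)" and
      2: "(u', act B v' (f x)) \<in> \<phi> ?g" "(v', f x) \<in> \<phi> ?h" "y' = germ B (imul B u' v') (f x)"
      using germ_ptB[OF tx(3)] by metis
    \<comment> \<open>All representatives of the left germ sit at its one base point, so
      \<open>v\<close> and \<open>v'\<close> move \<open>f x\<close> to the same point, as
      \<open>mul_cong\<close> demands.\<close>
    have "act B v' (f x) = act B v (f x)"
      using germ_ptB[OF sx(3)] 1 2 by metis
    then show "y = y'"
      using B.mul_cong relB[OF sx(3) 1(1)] relB[OF tx(3) 1(2) 2(2)] 1(3) 2 by metis
  next
    show "inj_on \<phi> K" by (rule inj\<phi>)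
  qed
  have "top_groupoid_iso (germ_groupoid A) (germ_groupoid B) \<phi> f"
    unfolding top_groupoid_iso_def
  proof (intro conjI ballI impI)
    show "homeomorphic_map (units (germ_groupoid A)) (units (germ_groupoid B)) f"
      using homeo by (simp add: germ_groupoid_def)
  next
    fix g h
    assume "g \<in> topspace (arrows (germ_groupoid A))" "h \<in> topspace (arrows (germ_groupoid A))"
      and *: "gdom (germ_groupoid A) g = gran (germ_groupoid A) h"
    then obtain s x t y where g: "g = germ A s x" "s \<in> isg B" "x \<in> adom A s" "x \<in> X"
      and h: "h = germ A t y" "t \<in> isg B" "y \<in> adom A t" "y \<in> X"
      using arrowsE by meson
    have "x = act A t y" using * gdomA[OF g(2-4)] granA[OF h(2-4)] g(1) h(1) by simp
    then show "gmul (germ_groupoid B) (\<phi> g) (\<phi> h) = \<phi> (gmul (germ_groupoid A) g h)"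
      using gmul[OF h(2-4) g(2)] g h by simp
  next
    fix g assume "g \<in> topspace (arrows (germ_groupoid A))"
    then obtain s x where g: "g = germ A s x" "s \<in> isg B" "x \<in> adom A s" "x \<in> X"
      using arrowsE by meson
    show "gdom (germ_groupoid B) (\<phi> g) = f (gdom (germ_groupoid A) g)"
      using gdom[OF g(2-4)] gdomA[OF g(2-4)] g(1) by simp
    show "gran (germ_groupoid B) (\<phi> g) = f (gran (germ_groupoid A) g)"
      using gran[OF g(2-4)] g(1) by simp
    show "ginv (germ_groupoid B) (\<phi> g) = \<phi> (ginv (germ_groupoid A) g)"
      using ginv[OF g(2-4)] g(1) by simp
  qed (rule arrows)
  then show ?thesis unfolding topologically_isomorphic_def by blast
qed


section \<open>Partial translations\<close>

lemma pinverse_eq_Some: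
  assumes "inj_on f (dom f)"
  shows "pinverse f y = Some x \<longleftrightarrow> f x = Some y"
proof -
  have "(THE x. f x = Some y) = x" if "f x = Some y" for x
    using that assms by (intro the_equality) (metis domI inj_onD)+
  then show ?thesis unfolding pinverse_def by auto
qed

lemma map_comp_restrict_Some:
  "e = Some |` A \<Longrightarrow> f = Some |` B \<Longrightarrow> e \<circ>\<^sub>m f = Some |` (A \<inter> B)"
  by (rule ext) (auto simp: map_comp_def restrict_map_def)

definition finitely_generated :: "'a cat \<Rightarrow> 'a set \<Rightarrow> bool" where
  "finitely_generated L A \<longleftrightarrow> (\<exists>\<Gamma>. finite \<Gamma> \<and> \<Gamma> \<subseteq> mor L \<and> A = (\<Union>\<gamma>\<in>\<Gamma>. ideal_of L \<gamma>))"

text \<open>Partial injections that are right module maps. The conditions are symmetric in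
  \<open>x\<close> and \<open>y\<close>, which gives closure under inverses. Finite generation of
  the domain is kept apart, because its induction uses finite alignment.\<close>

definition translation :: "'a cat \<Rightarrow> ('a \<rightharpoonup> 'a) \<Rightarrow> bool" where
  "translation L s \<longleftrightarrow> inj_on s (dom s) \<and>
     (\<forall>x y. s x = Some y \<longrightarrow> x \<in> mor L \<and> y \<in> mor L \<and> src L y = src L x \<and>
        (\<forall>\<delta>\<in>mor L. rng L \<delta> = src L x \<longrightarrow> s (cmp L x \<delta>) = Some (cmp L y \<delta>)))"

text \<open>The identity of \<open>\<gamma>\<Lambda>\<close>, through which morphisms are compared
  with idempotents.\<close>

definition range_idem :: "'a cat \<Rightarrow> 'a \<Rightarrow> ('a \<rightharpoonup> 'a)" where
  "range_idem L \<gamma> = tau L \<gamma> \<circ>\<^sub>m sigma L \<gamma>"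

locale finitely_aligned_lcsc =
  fixes L :: "'a cat"
  assumes category: "small_category L"
    and left_cancellative: "left_cancellative L"
    and finitely_aligned: "finitely_aligned L"
begin

lemma
  assumes "\<alpha> \<in> mor L"
  shows src_mor: "src L \<alpha> \<in> mor L" and src_src: "src L (src L \<alpha>) = src L \<alpha>"
    and rng_src: "rng L (src L \<alpha>) = src L \<alpha>" and cmp_src: "cmp L \<alpha> (src L \<alpha>) = \<alpha>"
    and cmp_rng: "cmp L (rng L \<alpha>) \<alpha> = \<alpha>"
  using category assms unfolding small_category_def by auto

lemma
  assumes "\<alpha> \<in> mor L" "\<beta> \<in> mor L" "src L \<alpha> = rng L \<beta>"
  shows cmp_mor: "cmp L \<alpha> \<beta> \<in> mor L" and src_cmp: "src L (cmp L \<alpha> \<beta>) = src L \<beta>"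
    and rng_cmp: "rng L (cmp L \<alpha> \<beta>) = rng L \<alpha>"
  using category assms unfolding small_category_def by auto

lemma cmp_assoc:
  assumes "\<alpha> \<in> mor L" "\<beta> \<in> mor L" "\<gamma> \<in> mor L" "src L \<alpha> = rng L \<beta>" "src L \<beta> = rng L \<gamma>"
  shows "cmp L (cmp L \<alpha> \<beta>) \<gamma> = cmp L \<alpha> (cmp L \<beta> \<gamma>)"
  using category assms unfolding small_category_def by auto

lemma ideal_iff: "\<beta> \<in> ideal_of L \<alpha> \<longleftrightarrow> (\<exists>\<delta>\<in>mor L. rng L \<delta> = src L \<alpha> \<and> \<beta> = cmp L \<alpha> \<delta>)"
  unfolding ideal_of_def by auto

lemma ideal_self: "\<alpha> \<in> mor L \<Longrightarrow> \<alpha> \<in> ideal_of L \<alpha>"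
  unfolding ideal_iff using src_mor rng_src cmp_src by metis

lemma ideal_mor: "\<alpha> \<in> mor L \<Longrightarrow> \<beta> \<in> ideal_of L \<alpha> \<Longrightarrow> \<beta> \<in> mor L"
  unfolding ideal_iff using cmp_mor by metis

lemma ideal_trans:
  assumes "\<alpha> \<in> mor L" "\<beta> \<in> ideal_of L \<alpha>" "\<gamma> \<in> ideal_of L \<beta>"
  shows "\<gamma> \<in> ideal_of L \<alpha>"
proof -
  obtain \<delta> where d: "\<delta> \<in> mor L" "rng L \<delta> = src L \<alpha>" "\<beta> = cmp L \<alpha> \<delta>"
    using assms(2) unfolding ideal_iff by blast
  obtain \<epsilon> where e: "\<epsilon> \<in> mor L" "rng L \<epsilon> = src L \<beta>" "\<gamma> = cmp L \<beta> \<epsilon>"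
    using assms(3) unfolding ideal_iff by blast
  have "src L \<delta> = rng L \<epsilon>" using d e src_cmp assms(1) by metis
  then show ?thesis
    unfolding ideal_iff using d e assms(1) cmp_assoc cmp_mor rng_cmp by metis
qed

text \<open>The domain of \<open>tau\<close> is written as the ideal of an identity morphism; since
  \<open>cmp L (rng L \<beta>) \<beta> = \<beta>\<close>, that ideal is all of the morphisms with
  this range.\<close>

lemma ideal_src: "\<alpha> \<in> mor L \<Longrightarrow> \<beta> \<in> ideal_of L (src L \<alpha>) \<longleftrightarrow> \<beta> \<in> mor L \<and> rng L \<beta> = src L \<alpha>"
  unfolding ideal_iff using src_mor src_src rng_src cmp_rng cmp_mor rng_cmp by metis

section \<open>Finitely generated right ideals\<close>

lemma finitely_generated_ideal: "\<alpha> \<in> mor L \<Longrightarrow> finitely_generated L (ideal_of L \<alpha>)"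
  unfolding finitely_generated_def by (rule exI[of _ "{\<alpha>}"]) auto

text \<open>Finite alignment handles two principal ideals; distributing the intersection over both
  unions leaves finitely many such pairs.\<close>

lemma finitely_generated_inter:
  assumes "finitely_generated L A" "finitely_generated L B"
  shows "finitely_generated L (A \<inter> B)"
proof -
  obtain P where P: "finite P" "P \<subseteq> mor L" "A = (\<Union>\<gamma>\<in>P. ideal_of L \<gamma>)"
    using assms(1) unfolding finitely_generated_def by blast
  obtain Q where Q: "finite Q" "Q \<subseteq> mor L" "B = (\<Union>\<gamma>\<in>Q. ideal_of L \<gamma>)"
    using assms(2) unfolding finitely_generated_def by blast
  have "\<forall>\<alpha>\<in>mor L. \<forall>\<beta>\<in>mor L. \<exists>\<Gamma>. finite \<Gamma> \<and> \<Gamma> \<subseteq> mor L \<and>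
      ideal_of L \<alpha> \<inter> ideal_of L \<beta> = (\<Union>\<gamma>\<in>\<Gamma>. ideal_of L \<gamma>)"
    using finitely_aligned unfolding finitely_aligned_def .
  then obtain G where G: "finite (G \<alpha> \<beta>) \<and> G \<alpha> \<beta> \<subseteq> mor L \<and>
      ideal_of L \<alpha> \<inter> ideal_of L \<beta> = (\<Union>\<gamma>\<in>G \<alpha> \<beta>. ideal_of L \<gamma>)"
    if "\<alpha> \<in> mor L" "\<beta> \<in> mor L" for \<alpha> \<beta>
    by metis
  have "A \<inter> B = (\<Union>\<alpha>\<in>P. \<Union>\<beta>\<in>Q. ideal_of L \<alpha> \<inter> ideal_of L \<beta>)"
    using P(3) Q(3) by blast
  also have "\<dots> = (\<Union>\<alpha>\<in>P. \<Union>\<beta>\<in>Q. \<Union>\<gamma>\<in>G \<alpha> \<beta>. ideal_of L \<gamma>)"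
  proof (intro SUP_cong refl)
    fix \<alpha> \<beta> assume "\<alpha> \<in> P" "\<beta> \<in> Q"
    then show "ideal_of L \<alpha> \<inter> ideal_of L \<beta> = (\<Union>\<gamma>\<in>G \<alpha> \<beta>. ideal_of L \<gamma>)"
      using G P(2) Q(2) by blast
  qed
  also have "\<dots> = (\<Union>\<gamma>\<in>(\<Union>\<alpha>\<in>P. \<Union>\<beta>\<in>Q. G \<alpha> \<beta>). ideal_of L \<gamma>)"
    by simp
  finally have "A \<inter> B = (\<Union>\<gamma>\<in>(\<Union>\<alpha>\<in>P. \<Union>\<beta>\<in>Q. G \<alpha> \<beta>). ideal_of L \<gamma>)" .
  moreover have "finite (\<Union>\<alpha>\<in>P. \<Union>\<beta>\<in>Q. G \<alpha> \<beta>)"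
    using G P(1,2) Q(1,2) by (intro finite_UN_I) auto
  moreover have "(\<Union>\<alpha>\<in>P. \<Union>\<beta>\<in>Q. G \<alpha> \<beta>) \<subseteq> mor L"
    using G P(2) Q(2) by (intro UN_least) (meson subsetD)
  ultimately show ?thesis unfolding finitely_generated_def by blast
qed

section \<open>Maps that commute with right multiplication\<close>

lemma translationD:
  assumes "translation L s" "s x = Some y"
  shows "x \<in> mor L" "y \<in> mor L" "src L y = src L x"
    "\<delta> \<in> mor L \<Longrightarrow> rng L \<delta> = src L x \<Longrightarrow> s (cmp L x \<delta>) = Some (cmp L y \<delta>)"
  using assms unfolding translation_def by blast+

lemma translation_inj: "translation L s \<Longrightarrow> s x = Some y \<Longrightarrow> s x' = Some y \<Longrightarrow> x = x'"
  unfolding translation_def by (metis domI inj_onD)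

lemma translation_ideal:
  assumes "translation L s" "s x = Some y" "x' \<in> ideal_of L x"
  shows "\<exists>y'\<in>ideal_of L y. s x' = Some y'"
proof -
  obtain \<delta> where "\<delta> \<in> mor L" "rng L \<delta> = src L x" "x' = cmp L x \<delta>"
    using assms(3) unfolding ideal_iff by blast
  then have "cmp L y \<delta> \<in> ideal_of L y" "s x' = Some (cmp L y \<delta>)"
    using translationD[OF assms(1,2)] unfolding ideal_iff by auto
  then show ?thesis by blast
qed

text \<open>The cofactor \<delta> of \<open>y'\<close> over \<open>y\<close> also composes with
  \<open>x\<close>, because sources are preserved. Hence \<open>s\<close> maps the ideal of
  \<open>x\<close> onto that of \<open>y\<close>.\<close>

lemma translation_ideal_image:
  assumes "translation L s" "s x = Some y" "y' \<in> ideal_of L y"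
  shows "\<exists>x'\<in>ideal_of L x. s x' = Some y'"
proof -
  obtain \<delta> where "\<delta> \<in> mor L" "rng L \<delta> = src L x" "y' = cmp L y \<delta>"
    using assms(3) translationD[OF assms(1,2)] unfolding ideal_iff by metis
  then have "cmp L x \<delta> \<in> ideal_of L x" "s (cmp L x \<delta>) = Some y'"
    using translationD[OF assms(1,2)] unfolding ideal_iff by auto
  then show ?thesis by blast
qed

text \<open>Both values at \<open>cmp L x \<delta>\<close> are forced to be
  \<open>cmp L y \<delta>\<close>. Agreement at one morphism spreads to its ideal, which reduces
  germs at a path to single values.\<close>

lemma translation_agree:
  assumes "translation L s" "translation L t" "s x = Some y" "t x = Some y" "x' \<in> ideal_of L x"
  shows "\<exists>y'\<in>ideal_of L y. s x' = Some y' \<and> t x' = Some y'"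
proof -
  obtain \<delta> where "\<delta> \<in> mor L" "rng L \<delta> = src L x" "x' = cmp L x \<delta>"
    using assms(5) unfolding ideal_iff by blast
  then have "cmp L y \<delta> \<in> ideal_of L y" "s x' = Some (cmp L y \<delta>)" "t x' = Some (cmp L y \<delta>)"
    using translationD[OF assms(1,3)] translationD[OF assms(2,4)] unfolding ideal_iff by auto
  then show ?thesis by blast
qed

lemma pinverse_translation: "translation L s \<Longrightarrow> pinverse s y = Some x \<longleftrightarrow> s x = Some y"
  unfolding translation_def using pinverse_eq_Some by metis

lemma translation_pinverse:
  assumes "translation L s" shows "translation L (pinverse s)"
proof -
  have "inj_on (pinverse s) (dom (pinverse s))"
    using pinverse_translation[OF assms] by (intro inj_onI) (metis domD option.inject)
  then show ?thesis
    unfolding translation_def pinverse_translation[OF assms]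
    using translationD[OF assms] by metis
qed

lemma translation_comp:
  assumes s: "translation L s" and t: "translation L t" shows "translation L (s \<circ>\<^sub>m t)"
proof -
  have iff: "(s \<circ>\<^sub>m t) x = Some y \<longleftrightarrow> (\<exists>z. t x = Some z \<and> s z = Some y)" for x y
    by (rule map_comp_Some_iff)
  have "inj_on (s \<circ>\<^sub>m t) (dom (s \<circ>\<^sub>m t))"
  proof (rule inj_onI)
    fix x x' assume "x \<in> dom (s \<circ>\<^sub>m t)" "(s \<circ>\<^sub>m t) x = (s \<circ>\<^sub>m t) x'"
    then obtain y where "(s \<circ>\<^sub>m t) x = Some y" "(s \<circ>\<^sub>m t) x' = Some y" by (metis domD)
    then show "x = x'" unfolding iff using translation_inj s t by metis
  qed
  moreover have "x \<in> mor L \<and> y \<in> mor L \<and> src L y = src L x \<and>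
      (\<forall>\<delta>\<in>mor L. rng L \<delta> = src L x \<longrightarrow> (s \<circ>\<^sub>m t) (cmp L x \<delta>) = Some (cmp L y \<delta>))"
    if st: "(s \<circ>\<^sub>m t) x = Some y" for x y
  proof -
    obtain z where "t x = Some z" "s z = Some y" using st unfolding iff by blast
    then show ?thesis
      unfolding iff
      using translationD[OF t \<open>t x = Some z\<close>] translationD[OF s \<open>s z = Some y\<close>] by auto
  qed
  ultimately show ?thesis unfolding translation_def by blast
qed

lemma tau_eq_Some:
  assumes "\<alpha> \<in> mor L"
  shows "tau L \<alpha> x = Some y \<longleftrightarrow> x \<in> mor L \<and> rng L x = src L \<alpha> \<and> y = cmp L \<alpha> x"
  unfolding tau_def using ideal_src[OF assms] by auto

lemma translation_tau:
  assumes "\<alpha> \<in> mor L" shows "translation L (tau L \<alpha>)"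
proof -
  have "inj_on (tau L \<alpha>) (dom (tau L \<alpha>))"
  proof (rule inj_onI)
    fix x x' assume "x \<in> dom (tau L \<alpha>)" "tau L \<alpha> x = tau L \<alpha> x'"
    then obtain y where "tau L \<alpha> x = Some y" "tau L \<alpha> x' = Some y" by (metis domD)
    then show "x = x'"
      \<comment> \<open>Left cancellation enters here, as injectivity of the generators.\<close>
      using left_cancellative assms unfolding tau_eq_Some[OF assms] left_cancellative_def by metis
  qed
  then show ?thesis
    unfolding translation_def tau_eq_Some[OF assms]
    using assms cmp_mor src_cmp rng_cmp cmp_assoc by simp
qed

text \<open>Generators go to generators, as \<open>s\<close> maps the ideal of a generator onto that
  of its image. Containment in \<open>dom s\<close> guarantees that every generator has an
  image.\<close>

lemma finitely_generated_image:
  assumes "translation L s" "finitely_generated L A" "A \<subseteq> dom s"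
  shows "finitely_generated L {y. \<exists>x\<in>A. s x = Some y}"
proof -
  obtain P where P: "finite P" "P \<subseteq> mor L" "A = (\<Union>\<gamma>\<in>P. ideal_of L \<gamma>)"
    using assms(2) unfolding finitely_generated_def by blast
  define Q where "Q = {y. \<exists>x\<in>P. s x = Some y}"
  have "Q \<subseteq> (the \<circ> s) ` P" unfolding Q_def by force
  then have "finite Q" using P(1) finite_surj by blast
  moreover have "Q \<subseteq> mor L" unfolding Q_def using translationD[OF assms(1)] by blast
  moreover have "{y. \<exists>x\<in>A. s x = Some y} = (\<Union>\<gamma>\<in>Q. ideal_of L \<gamma>)"
  proof (intro set_eqI iffI)
    fix y assume "y \<in> {y. \<exists>x\<in>A. s x = Some y}"
    then obtain p x where p: "p \<in> P" "x \<in> ideal_of L p" "s x = Some y" using P by blast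
    have "p \<in> A" using p(1) P ideal_self by blast
    then obtain q where q: "s p = Some q" using assms(3) by blast
    then have "y \<in> ideal_of L q" using translation_ideal[OF assms(1) q p(2)] p(3) by auto
    then show "y \<in> (\<Union>\<gamma>\<in>Q. ideal_of L \<gamma>)" unfolding Q_def using p(1) q by blast
  next
    fix y assume "y \<in> (\<Union>\<gamma>\<in>Q. ideal_of L \<gamma>)"
    then obtain p q where "p \<in> P" "s p = Some q" "y \<in> ideal_of L q" unfolding Q_def by blast
    then show "y \<in> {y. \<exists>x\<in>A. s x = Some y}"
      using translation_ideal_image[OF assms(1)] P(3) by blast
  qed
  ultimately show ?thesis unfolding finitely_generated_def by blast
qed

lemma cat_isg_translation: "s \<in> cat_isg L \<Longrightarrow> translation L s"
proof (induction rule: cat_isg.induct)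
  case (tau \<alpha>) then show ?case by (rule translation_tau)
next
  case (sigma \<alpha>) then show ?case unfolding sigma_def by (intro translation_pinverse translation_tau)
next
  case (mult s t) then show ?case by (intro translation_comp)
next
  case (inverse s) then show ?case by (intro translation_pinverse)
qed

lemma dom_pinverse: "translation L s \<Longrightarrow> dom (pinverse s) = {y. \<exists>x\<in>dom s. s x = Some y}"
  using pinverse_translation by (auto simp: dom_def)

lemma finitely_generated_dom: "s \<in> cat_isg L \<Longrightarrow> finitely_generated L (dom s)"
proof (induction rule: cat_isg.induct)
  case (tau \<alpha>)
  have "dom (tau L \<alpha>) = ideal_of L (src L \<alpha>)" unfolding tau_def dom_def by auto
  then show ?case using finitely_generated_ideal src_mor tau by simp
next
  case (sigma \<alpha>)
  have "dom (tau L \<alpha>) = ideal_of L (src L \<alpha>)" unfolding tau_def dom_def by auto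
  then show ?case
    unfolding sigma_def dom_pinverse[OF translation_tau[OF sigma]]
    using finitely_generated_image translation_tau finitely_generated_ideal src_mor sigma by simp
next
  case (mult s t)
  then have s: "translation L s" and t: "translation L t" by (auto intro: cat_isg_translation)
  \<comment> \<open>The domain of a product is the preimage under \<open>t\<close> of the part of
    the range of \<open>t\<close> inside \<open>dom s\<close>. Ranges are handled as domains of
    \<open>pinverse\<close>; the intersection is where finite alignment is used.\<close>
  let ?A = "dom s \<inter> dom (pinverse t)"
  have "finitely_generated L (dom (pinverse t))"
    unfolding dom_pinverse[OF t] using finitely_generated_image t mult by blast
  then have "finitely_generated L {x. \<exists>y\<in>?A. pinverse t y = Some x}"
    using finitely_generated_image[OF translation_pinverse[OF t]] finitely_generated_inter mult
    by simp
  moreover have "{x. \<exists>y\<in>?A. pinverse t y = Some x} = dom (s \<circ>\<^sub>m t)"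
    unfolding dom_pinverse[OF t] pinverse_translation[OF t]
    by (auto simp: map_comp_Some_iff dom_def)
  ultimately show ?case by simp
next
  case (inverse s)
  then show ?case
    unfolding dom_pinverse[OF cat_isg_translation[OF inverse(1)]]
    using finitely_generated_image cat_isg_translation by blast
qed

lemma dom_ideal: "s \<in> cat_isg L \<Longrightarrow> x \<in> dom s \<Longrightarrow> x' \<in> ideal_of L x \<Longrightarrow> x' \<in> dom s"
  using translation_ideal cat_isg_translation by blast

lemma dom_mor: "s \<in> cat_isg L \<Longrightarrow> x \<in> dom s \<Longrightarrow> x \<in> mor L"
  using translationD cat_isg_translation by blast


section \<open>Idempotents\<close>

text \<open>If \<open>e\<close> sends \<open>x\<close> to \<open>y\<close>, idempotence makes
  \<open>y\<close> a fixed point and injectivity gives \<open>x = y\<close>. Idempotents are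
  therefore determined by their domains.\<close>

lemma cat_idem_iff: "e \<in> cat_idem L \<longleftrightarrow> e \<in> cat_isg L \<and> e = Some |` dom e"
proof
  assume e: "e \<in> cat_idem L"
  then have isg: "e \<in> cat_isg L" and ee: "e \<circ>\<^sub>m e = e" by (auto simp: cat_idem_def)
  have "x = y" if "e x = Some y" for x y
  proof -
    have "e y = Some y" using that ee map_comp_Some_iff[of e e x y] by auto
    then show ?thesis using that translation_inj[OF cat_isg_translation[OF isg]] by metis
  qed
  then have "e = Some |` dom e" by (intro ext) (auto simp: restrict_map_def domIff split: if_splits)
  then show "e \<in> cat_isg L \<and> e = Some |` dom e" using isg by simp
next
  assume e: "e \<in> cat_isg L \<and> e = Some |` dom e"
  then have "e \<circ>\<^sub>m e = Some |` (dom e \<inter> dom e)" by (intro map_comp_restrict_Some) simp_all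
  then have "e \<circ>\<^sub>m e = e" using e by (metis Int_absorb)
  then show "e \<in> cat_idem L" unfolding cat_idem_def using e by blast
qed

lemma idem_isg: "e \<in> cat_idem L \<Longrightarrow> e \<in> cat_isg L" and idem_eq: "e \<in> cat_idem L \<Longrightarrow> e = Some |` dom e"
  using cat_idem_iff by blast+

lemma idem_eqI: "e \<in> cat_idem L \<Longrightarrow> f \<in> cat_idem L \<Longrightarrow> dom e = dom f \<Longrightarrow> e = f"
  using idem_eq by metis

lemma idem_comp:
  assumes "e \<in> cat_idem L" "f \<in> cat_idem L"
  shows "e \<circ>\<^sub>m f \<in> cat_idem L" and "dom (e \<circ>\<^sub>m f) = dom e \<inter> dom f"
proof -
  have *: "e \<circ>\<^sub>m f = Some |` (dom e \<inter> dom f)"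
    by (rule map_comp_restrict_Some[OF idem_eq[OF assms(1)] idem_eq[OF assms(2)]])
  show d: "dom (e \<circ>\<^sub>m f) = dom e \<inter> dom f" unfolding * by (auto simp: restrict_map_def dom_def)
  show "e \<circ>\<^sub>m f \<in> cat_idem L"
    unfolding cat_idem_iff d using * idem_isg[OF assms(1)] idem_isg[OF assms(2)]
    by (blast intro: cat_isg.mult)
qed

lemma idem_le_iff:
  assumes "e \<in> cat_idem L" "f \<in> cat_idem L"
  shows "idem_le e f \<longleftrightarrow> dom e \<subseteq> dom f"
  unfolding idem_le_def using idem_comp[OF assms] idem_eqI[OF assms(1)] by (metis inf.absorb_iff1)

text \<open>Conjugation moves a partial identity along \<open>s\<close>, so the filter action
  becomes the forward image of domains.\<close>

lemma idem_conjugate: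
  assumes "s \<in> cat_isg L" "e \<in> cat_idem L"
  shows "s \<circ>\<^sub>m e \<circ>\<^sub>m pinverse s \<in> cat_idem L"
    and "dom (s \<circ>\<^sub>m e \<circ>\<^sub>m pinverse s) = {y. \<exists>x\<in>dom e. s x = Some y}"
proof -
  have e: "e x = Some z \<longleftrightarrow> x \<in> dom e \<and> z = x" for x z
    using fun_cong[OF idem_eq[OF assms(2)], of x] by (auto simp: restrict_map_def)
  have t: "translation L s" using assms cat_isg_translation by blast
  have iff: "(s \<circ>\<^sub>m e \<circ>\<^sub>m pinverse s) y = Some z \<longleftrightarrow> z = y \<and> (\<exists>x\<in>dom e. s x = Some y)" for y z
    unfolding map_comp_Some_iff pinverse_translation[OF t] e by (auto simp: e)
  show d: "dom (s \<circ>\<^sub>m e \<circ>\<^sub>m pinverse s) = {y. \<exists>x\<in>dom e. s x = Some y}"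
    using iff unfolding dom_def by auto
  have "s \<circ>\<^sub>m e \<circ>\<^sub>m pinverse s = Some |` dom (s \<circ>\<^sub>m e \<circ>\<^sub>m pinverse s)"
  proof
    fix y show "(s \<circ>\<^sub>m e \<circ>\<^sub>m pinverse s) y = (Some |` dom (s \<circ>\<^sub>m e \<circ>\<^sub>m pinverse s)) y"
    proof (cases "(s \<circ>\<^sub>m e \<circ>\<^sub>m pinverse s) y")
      case None then show ?thesis by (simp add: restrict_map_def domIff)
    next
      case (Some z)
      then show ?thesis using iff by (auto simp: restrict_map_def domIff)
    qed
  qed
  then show "s \<circ>\<^sub>m e \<circ>\<^sub>m pinverse s \<in> cat_idem L"
    unfolding cat_idem_iff using assms idem_isg by (blast intro: cat_isg.intros)
qed

lemma idem_pinverse_comp: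
  assumes "s \<in> cat_isg L"
  shows "pinverse s \<circ>\<^sub>m s \<in> cat_idem L" and "dom (pinverse s \<circ>\<^sub>m s) = dom s"
proof -
  have t: "translation L s" using assms cat_isg_translation by blast
  have iff: "(pinverse s \<circ>\<^sub>m s) x = Some z \<longleftrightarrow> z = x \<and> x \<in> dom s" for x z
    unfolding map_comp_Some_iff pinverse_translation[OF t] using translation_inj[OF t] by auto
  show d: "dom (pinverse s \<circ>\<^sub>m s) = dom s" using iff unfolding dom_def[of "pinverse s \<circ>\<^sub>m s"] by auto
  have "pinverse s \<circ>\<^sub>m s = Some |` dom s"
  proof
    fix x show "(pinverse s \<circ>\<^sub>m s) x = (Some |` dom s) x"
      using iff[of x] by (cases "(pinverse s \<circ>\<^sub>m s) x") (auto simp: restrict_map_def)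
  qed
  then show "pinverse s \<circ>\<^sub>m s \<in> cat_idem L"
    unfolding cat_idem_iff d using assms by (blast intro: cat_isg.intros)
qed

lemma tau_sigma_eq_Some:
  assumes "\<alpha> \<in> mor L" "\<beta> \<in> mor L" "src L \<alpha> = src L \<beta>"
  shows "(tau L \<alpha> \<circ>\<^sub>m sigma L \<beta>) x = Some y \<longleftrightarrow>
    (\<exists>\<delta>\<in>mor L. rng L \<delta> = src L \<beta> \<and> x = cmp L \<beta> \<delta> \<and> y = cmp L \<alpha> \<delta>)"
proof -
  have "sigma L \<beta> x = Some \<delta> \<longleftrightarrow> \<delta> \<in> mor L \<and> rng L \<delta> = src L \<beta> \<and> x = cmp L \<beta> \<delta>" for \<delta>
    unfolding sigma_def pinverse_translation[OF translation_tau[OF assms(2)]]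
    by (rule tau_eq_Some[OF assms(2)])
  then show ?thesis
    unfolding map_comp_Some_iff tau_eq_Some[OF assms(1)] using assms(3) by metis
qed

lemma range_idem:
  assumes "\<gamma> \<in> mor L"
  shows range_idem_in: "range_idem L \<gamma> \<in> cat_idem L" and dom_range_idem: "dom (range_idem L \<gamma>) = ideal_of L \<gamma>"
proof -
  have iff: "range_idem L \<gamma> x = Some y \<longleftrightarrow> y = x \<and> x \<in> ideal_of L \<gamma>" for x y
    unfolding range_idem_def tau_sigma_eq_Some[OF assms assms refl] ideal_iff by auto
  show d: "dom (range_idem L \<gamma>) = ideal_of L \<gamma>" using iff unfolding dom_def by auto
  have "range_idem L \<gamma> = Some |` ideal_of L \<gamma>"
  proof
    fix x show "range_idem L \<gamma> x = (Some |` ideal_of L \<gamma>) x"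
      using iff[of x] by (cases "range_idem L \<gamma> x") (auto simp: restrict_map_def)
  qed
  then show "range_idem L \<gamma> \<in> cat_idem L"
    unfolding cat_idem_iff d using assms unfolding range_idem_def by (blast intro: cat_isg.intros)
qed


section \<open>The action on paths\<close>

text \<open>The action as a formula in \<open>s\<close> alone, against which every presentation of
  \<open>s\<close> as a join is compared in \<open>basic_path_act_eq\<close>.\<close>

definition push :: "('a \<rightharpoonup> 'a) \<Rightarrow> 'a set \<Rightarrow> 'a set" where
  "push s F = {\<alpha> \<in> mor L. \<exists>\<gamma>\<in>F. \<exists>y\<in>ideal_of L \<alpha>. s \<gamma> = Some y}"

lemma path_mor: "F \<in> path_space_set L \<Longrightarrow> \<alpha> \<in> F \<Longrightarrow> \<alpha> \<in> mor L"
  unfolding path_space_set_def by blast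

lemma path_hereditary:
  "F \<in> path_space_set L \<Longrightarrow> \<beta> \<in> F \<Longrightarrow> \<alpha> \<in> mor L \<Longrightarrow> \<beta> \<in> ideal_of L \<alpha> \<Longrightarrow> \<alpha> \<in> F"
  unfolding path_space_set_def path_le_def by blast

lemma path_directed:
  "F \<in> path_space_set L \<Longrightarrow> \<alpha> \<in> F \<Longrightarrow> \<beta> \<in> F \<Longrightarrow> \<exists>\<gamma>\<in>F. \<gamma> \<in> ideal_of L \<alpha> \<and> \<gamma> \<in> ideal_of L \<beta>"
  unfolding path_space_set_def path_le_def by blast

text \<open>An upper bound in \<open>F\<close> of a point of \<open>dom s\<close> and a point of
  \<open>dom t\<close> lies in both domains, as these are right ideals. This makes the idempotents
  that meet a path closed under products.\<close>

lemma path_meets_inter: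
  assumes "F \<in> path_space_set L" "s \<in> cat_isg L" "t \<in> cat_isg L" "F \<inter> dom s \<noteq> {}" "F \<inter> dom t \<noteq> {}"
  shows "F \<inter> (dom s \<inter> dom t) \<noteq> {}"
proof -
  obtain \<alpha> \<beta> where ab: "\<alpha> \<in> F" "\<alpha> \<in> dom s" "\<beta> \<in> F" "\<beta> \<in> dom t" using assms by blast
  obtain \<gamma> where "\<gamma> \<in> F" "\<gamma> \<in> ideal_of L \<alpha>" "\<gamma> \<in> ideal_of L \<beta>"
    using path_directed assms(1) ab by blast
  then show ?thesis using dom_ideal assms(2,3) ab by blast
qed

section \<open>Presentations as joins and the path action\<close>

lemma join_rep_Some:
  assumes "join_rep L s D"
  shows "s x = Some y \<longleftrightarrow> (\<exists>(\<alpha>, \<beta>)\<in>D. \<exists>\<delta>\<in>mor L. rng L \<delta> = src L \<beta> \<and> x = cmp L \<beta> \<delta> \<and> y = cmp L \<alpha> \<delta>)"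
proof -
  have "s x = Some y \<longleftrightarrow> (\<exists>(\<alpha>, \<beta>)\<in>D. (tau L \<alpha> \<circ>\<^sub>m sigma L \<beta>) x = Some y)"
    using assms unfolding join_rep_def Map.graph_def by (fastforce simp: set_eq_iff)
  moreover have "(tau L \<alpha> \<circ>\<^sub>m sigma L \<beta>) x = Some y \<longleftrightarrow>
      (\<exists>\<delta>\<in>mor L. rng L \<delta> = src L \<beta> \<and> x = cmp L \<beta> \<delta> \<and> y = cmp L \<alpha> \<delta>)" if "(\<alpha>, \<beta>) \<in> D" for \<alpha> \<beta>
    using assms that unfolding join_rep_def by (intro tau_sigma_eq_Some) auto
  ultimately show ?thesis by fastforce
qed

lemma join_rep_mor: "join_rep L s D \<Longrightarrow> (\<alpha>, \<beta>) \<in> D \<Longrightarrow> \<alpha> \<in> mor L \<and> \<beta> \<in> mor L \<and> src L \<alpha> = src L \<beta>"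
  unfolding join_rep_def by auto

lemma join_rep_exists:
  assumes s: "s \<in> cat_isg L"
  shows "\<exists>D. join_rep L s D"
proof -
  have t: "translation L s" using s by (rule cat_isg_translation)
  obtain \<Gamma> where G: "finite \<Gamma>" "\<Gamma> \<subseteq> mor L" "dom s = (\<Union>\<gamma>\<in>\<Gamma>. ideal_of L \<gamma>)"
    using finitely_generated_dom[OF s] unfolding finitely_generated_def by blast
  \<comment> \<open>One pair per generator of \<open>dom s\<close>: on the ideal of \<gamma> the map
    \<open>s\<close> strips \<gamma> and multiplies by its value at \<gamma>.\<close>
  define D where "D = (\<lambda>\<gamma>. (the (s \<gamma>), \<gamma>)) ` \<Gamma>"
  have sG: "s \<gamma> = Some (the (s \<gamma>))" if "\<gamma> \<in> \<Gamma>" for \<gamma>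
    using that G ideal_self by (metis UN_I domD option.sel subsetD)
  have D: "\<alpha> \<in> mor L \<and> \<beta> \<in> mor L \<and> src L \<alpha> = src L \<beta> \<and> \<beta> \<in> \<Gamma> \<and> s \<beta> = Some \<alpha>"
    if "(\<alpha>, \<beta>) \<in> D" for \<alpha> \<beta>
    using that sG translationD[OF t] unfolding D_def by auto
  have graph: "Map.graph (tau L \<alpha> \<circ>\<^sub>m sigma L \<beta>) = {(x, y). x \<in> ideal_of L \<beta> \<and> s x = Some y}"
    if "(\<alpha>, \<beta>) \<in> D" for \<alpha> \<beta>
  proof -
    have ts: "(tau L \<alpha> \<circ>\<^sub>m sigma L \<beta>) x = Some y \<longleftrightarrow>
      (\<exists>\<delta>\<in>mor L. rng L \<delta> = src L \<beta> \<and> x = cmp L \<beta> \<delta> \<and> y = cmp L \<alpha> \<delta>)" for x y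
      using D[OF that] by (intro tau_sigma_eq_Some) auto
    have "s (cmp L \<beta> \<delta>) = Some (cmp L \<alpha> \<delta>)" if "\<delta> \<in> mor L" "rng L \<delta> = src L \<beta>" for \<delta>
      using D[OF \<open>(\<alpha>, \<beta>) \<in> D\<close>] translationD[OF t] that by blast
    then show ?thesis unfolding Map.graph_def ts ideal_iff by auto
  qed
  have "join_rep L s D"
    unfolding join_rep_def
  proof (intro conjI)
    show "finite D" using G(1) by (simp add: D_def)
    show "\<forall>(\<alpha>, \<beta>)\<in>D. \<alpha> \<in> mor L \<and> \<beta> \<in> mor L \<and> src L \<alpha> = src L \<beta>" using D by blast
    have "(\<Union>(\<alpha>, \<beta>)\<in>D. Map.graph (tau L \<alpha> \<circ>\<^sub>m sigma L \<beta>))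
        = (\<Union>(\<alpha>, \<beta>)\<in>D. {(x, y). x \<in> ideal_of L \<beta> \<and> s x = Some y})"
    proof (intro SUP_cong refl)
      fix p assume "p \<in> D"
      then show "(case p of (\<alpha>, \<beta>) \<Rightarrow> Map.graph (tau L \<alpha> \<circ>\<^sub>m sigma L \<beta>)) =
          (case p of (\<alpha>, \<beta>) \<Rightarrow> {(x, y). x \<in> ideal_of L \<beta> \<and> s x = Some y})"
        using graph[of "fst p" "snd p"] by (simp only: case_prod_beta prod.collapse)
    qed
    also have "\<dots> = (\<Union>\<beta>\<in>\<Gamma>. {(x, y). x \<in> ideal_of L \<beta> \<and> s x = Some y})"
      unfolding D_def by simp
    also have "\<dots> = Map.graph s" using G(3) unfolding Map.graph_def by blast
    finally show "Map.graph s = (\<Union>(\<alpha>, \<beta>)\<in>D. Map.graph (tau L \<alpha> \<circ>\<^sub>m sigma L \<beta>))" by simp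
  qed
  then show ?thesis by blast
qed

text \<open>If \<open>F\<close> meets \<open>dom s\<close> at \<gamma>, then \<gamma> extends some
  \<beta> of any presentation, and \<beta> is in \<open>F\<close> by heredity; conversely each
  \<beta> itself belongs to \<open>dom s\<close>. So the domain of the action does not depend on the
  presentation.\<close>

lemma join_rep_meets:
  assumes s: "s \<in> cat_isg L" and F: "F \<in> path_space_set L"
  shows "(\<exists>D. join_rep L s D \<and> (\<exists>(\<alpha>, \<beta>)\<in>D. \<beta> \<in> F)) \<longleftrightarrow> F \<inter> dom s \<noteq> {}"
proof
  assume "\<exists>D. join_rep L s D \<and> (\<exists>(\<alpha>, \<beta>)\<in>D. \<beta> \<in> F)"
  then obtain D \<alpha> \<beta> where D: "join_rep L s D" "(\<alpha>, \<beta>) \<in> D" "\<beta> \<in> F" by blast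
  have b: "\<beta> \<in> mor L" using join_rep_mor D by blast
  have "src L \<beta> \<in> mor L \<and> rng L (src L \<beta>) = src L \<beta> \<and> \<beta> = cmp L \<beta> (src L \<beta>)"
    using src_mor[OF b] rng_src[OF b] cmp_src[OF b] by simp
  then have "s \<beta> = Some (cmp L \<alpha> (src L \<beta>))"
    unfolding join_rep_Some[OF D(1)] using D(2) by blast
  then show "F \<inter> dom s \<noteq> {}" using D(3) by blast
next
  assume "F \<inter> dom s \<noteq> {}"
  then obtain \<gamma> y where \<gamma>: "\<gamma> \<in> F" "s \<gamma> = Some y" by blast
  obtain D where D: "join_rep L s D" using join_rep_exists[OF s] by blast
  then obtain \<alpha> \<beta> where ab: "(\<alpha>, \<beta>) \<in> D" "\<gamma> \<in> ideal_of L \<beta>"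
    using \<gamma>(2) unfolding join_rep_Some[OF D] ideal_iff by blast
  then have "\<beta> \<in> F" using path_hereditary[OF F \<gamma>(1)] join_rep_mor[OF D ab(1)] by blast
  then show "\<exists>D. join_rep L s D \<and> (\<exists>(\<alpha>, \<beta>)\<in>D. \<beta> \<in> F)" using D ab(1) by blast
qed

lemma basic_path_act_eq:
  assumes s: "s \<in> cat_isg L" and F: "F \<in> path_space_set L"
    and D: "join_rep L s D" "(\<alpha>, \<beta>) \<in> D" "\<beta> \<in> F"
  shows "basic_path_act L \<alpha> \<beta> F = push s F"
proof -
  have ab: "\<alpha> \<in> mor L" "\<beta> \<in> mor L" "src L \<alpha> = src L \<beta>" using join_rep_mor[OF D(1,2)] by auto
  have t: "translation L s" using s by (rule cat_isg_translation)
  have s\<gamma>: "s \<gamma> = Some (cmp L \<alpha> (the (sigma L \<beta> \<gamma>)))" if \<gamma>: "\<gamma> \<in> ideal_of L \<beta>" for \<gamma>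
  proof -
    obtain \<delta> where d: "\<delta> \<in> mor L" "rng L \<delta> = src L \<beta>" "\<gamma> = cmp L \<beta> \<delta>"
      using \<gamma> unfolding ideal_iff by blast
    have "sigma L \<beta> \<gamma> = Some \<delta>"
      unfolding sigma_def pinverse_translation[OF translation_tau[OF ab(2)]] tau_eq_Some[OF ab(2)]
      using d by blast
    moreover have "s \<gamma> = Some (cmp L \<alpha> \<delta>)"
      unfolding join_rep_Some[OF D(1)] using D(2) d by blast
    ultimately show ?thesis by simp
  qed
  have eq: "basic_path_act L \<alpha> \<beta> F
      = {a \<in> mor L. \<exists>\<gamma>\<in>F. \<gamma> \<in> ideal_of L \<beta> \<and> (\<exists>y\<in>ideal_of L a. s \<gamma> = Some y)}"
    unfolding basic_path_act_def segments_def path_le_def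
  proof (intro set_eqI iffI)
    fix a assume "a \<in> (\<Union>\<gamma>\<in>{\<gamma> \<in> F. \<gamma> \<in> ideal_of L \<beta>}.
      {a \<in> mor L. cmp L \<alpha> (the (sigma L \<beta> \<gamma>)) \<in> ideal_of L a})"
    then show "a \<in> {a \<in> mor L. \<exists>\<gamma>\<in>F. \<gamma> \<in> ideal_of L \<beta> \<and> (\<exists>y\<in>ideal_of L a. s \<gamma> = Some y)}"
      using s\<gamma> by blast
  next
    fix a assume "a \<in> {a \<in> mor L. \<exists>\<gamma>\<in>F. \<gamma> \<in> ideal_of L \<beta> \<and> (\<exists>y\<in>ideal_of L a. s \<gamma> = Some y)}"
    then obtain \<gamma> y where "a \<in> mor L" "\<gamma> \<in> F" "\<gamma> \<in> ideal_of L \<beta>" "y \<in> ideal_of L a" "s \<gamma> = Some y"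
      by blast
    then show "a \<in> (\<Union>\<gamma>\<in>{\<gamma> \<in> F. \<gamma> \<in> ideal_of L \<beta>}.
      {a \<in> mor L. cmp L \<alpha> (the (sigma L \<beta> \<gamma>)) \<in> ideal_of L a})"
      using s\<gamma>[of \<gamma>] by auto
  qed
  show ?thesis
    unfolding eq push_def
  proof (intro Collect_cong conj_cong refl iffI)
    fix a assume a: "a \<in> mor L" and "\<exists>\<gamma>\<in>F. \<exists>y\<in>ideal_of L a. s \<gamma> = Some y"
    then obtain \<gamma> y where g: "\<gamma> \<in> F" "y \<in> ideal_of L a" "s \<gamma> = Some y" by blast
    \<comment> \<open>The two sides differ in whether \<gamma> must extend \<beta>. Directedness
      replaces \<gamma> by a common extension of \<beta> and \<gamma> in \<open>F\<close>, whose
      image still extends \<open>a\<close>.\<close>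
    obtain \<gamma>' where g': "\<gamma>' \<in> F" "\<gamma>' \<in> ideal_of L \<beta>" "\<gamma>' \<in> ideal_of L \<gamma>"
      using path_directed[OF F D(3) g(1)] by blast
    then obtain y' where "y' \<in> ideal_of L y" "s \<gamma>' = Some y'"
      using translation_ideal[OF t g(3)] by blast
    then show "\<exists>\<gamma>\<in>F. \<gamma> \<in> ideal_of L \<beta> \<and> (\<exists>y\<in>ideal_of L a. s \<gamma> = Some y)"
      using g' ideal_trans[OF a g(2)] by blast
  qed blast
qed

lemma path_action_simps:
  "isg (path_action L) = cat_isg L" "imul (path_action L) = (\<circ>\<^sub>m)" "istar (path_action L) = pinverse"
  "space_of (path_action L) = subtopology (path_space L) (tight_paths L)"
  unfolding path_action_def by simp_all

lemma tight_path: "F \<in> tight_paths L \<Longrightarrow> F \<in> path_space_set L"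
  unfolding tight_paths_def by blast

lemma adom_path_action:
  "s \<in> cat_isg L \<Longrightarrow> adom (path_action L) s = {F \<in> tight_paths L. F \<inter> dom s \<noteq> {}}"
  unfolding path_action_def isg_action.simps using join_rep_meets[OF _ tight_path]
  by (intro Collect_cong conj_cong refl)

lemma act_path_action:
  assumes "s \<in> cat_isg L" "F \<in> path_space_set L" "F \<inter> dom s \<noteq> {}"
  shows "act (path_action L) s F = push s F"
  unfolding path_action_def isg_action.simps
proof (rule the_equality)
  obtain D \<alpha> \<beta> where "join_rep L s D" "(\<alpha>, \<beta>) \<in> D" "\<beta> \<in> F"
    using join_rep_meets[OF assms(1,2)] assms(3) by blast
  then show "\<exists>D. join_rep L s D \<and> (\<exists>(\<alpha>, \<beta>)\<in>D. \<beta> \<in> F \<and> push s F = basic_path_act L \<alpha> \<beta> F)"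
    using basic_path_act_eq[OF assms(1,2)] by blast
next
  fix F' assume "\<exists>D. join_rep L s D \<and> (\<exists>(\<alpha>, \<beta>)\<in>D. \<beta> \<in> F \<and> F' = basic_path_act L \<alpha> \<beta> F)"
  then show "F' = push s F" using basic_path_act_eq[OF assms(1,2)] by blast
qed

lemma push_memI: "s \<in> cat_isg L \<Longrightarrow> \<gamma> \<in> F \<Longrightarrow> s \<gamma> = Some y \<Longrightarrow> y \<in> push s F"
  unfolding push_def using translationD[OF cat_isg_translation] ideal_self by blast

lemma push_path:
  assumes s: "s \<in> cat_isg L" and F: "F \<in> path_space_set L" and meet: "F \<inter> dom s \<noteq> {}"
  shows "push s F \<in> path_space_set L"
proof -
  have t: "translation L s" using s by (rule cat_isg_translation)
  have "push s F \<noteq> {}" using push_memI[OF s] meet by blast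
  moreover have "\<alpha> \<in> push s F" if "\<beta> \<in> push s F" "\<alpha> \<in> mor L" "\<beta> \<in> ideal_of L \<alpha>" for \<alpha> \<beta>
    using that ideal_trans unfolding push_def by blast
  moreover have "\<exists>\<gamma>\<in>push s F. \<gamma> \<in> ideal_of L \<alpha> \<and> \<gamma> \<in> ideal_of L \<beta>"
    if ab: "\<alpha> \<in> push s F" "\<beta> \<in> push s F" for \<alpha> \<beta>
  proof -
    obtain \<gamma> y where a: "\<alpha> \<in> mor L" "\<gamma> \<in> F" "y \<in> ideal_of L \<alpha>" "s \<gamma> = Some y"
      using ab(1) unfolding push_def by blast
    obtain \<delta> z where b: "\<beta> \<in> mor L" "\<delta> \<in> F" "z \<in> ideal_of L \<beta>" "s \<delta> = Some z"
      using ab(2) unfolding push_def by blast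
    obtain \<epsilon> where e: "\<epsilon> \<in> F" "\<epsilon> \<in> ideal_of L \<gamma>" "\<epsilon> \<in> ideal_of L \<delta>"
      using path_directed[OF F a(2) b(2)] by blast
    obtain w where w: "w \<in> ideal_of L y" "s \<epsilon> = Some w"
      using translation_ideal[OF t a(4) e(2)] by blast
    moreover have "w \<in> ideal_of L z"
      using translation_ideal[OF t b(4) e(3)] w(2) by auto
    ultimately show ?thesis
      using push_memI[OF s e(1)] ideal_trans[OF a(1,3)] ideal_trans[OF b(1,3)] by blast
  qed
  ultimately show ?thesis
    unfolding path_space_set_def path_le_def by (auto simp: push_def)
qed

text \<open>The elements of \<open>F\<close> above \<gamma> are cofinal in \<open>F\<close>, and
  there \<open>s\<close> and \<open>t\<close> coincide; passing to a cofinal part leaves the set of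
  initial segments of the images unchanged.\<close>

lemma push_agree:
  assumes s: "s \<in> cat_isg L" and t: "t \<in> cat_isg L" and F: "F \<in> path_space_set L"
    and \<gamma>: "\<gamma> \<in> F" "s \<gamma> = Some y" "t \<gamma> = Some y"
  shows "push s F \<subseteq> push t F"
proof
  have ts: "translation L s" "translation L t" using s t by (auto intro: cat_isg_translation)
  fix \<alpha> assume "\<alpha> \<in> push s F"
  then obtain \<delta> z where d: "\<alpha> \<in> mor L" "\<delta> \<in> F" "z \<in> ideal_of L \<alpha>" "s \<delta> = Some z"
    unfolding push_def by blast
  obtain \<epsilon> where e: "\<epsilon> \<in> F" "\<epsilon> \<in> ideal_of L \<gamma>" "\<epsilon> \<in> ideal_of L \<delta>"
    using path_directed[OF F \<gamma>(1) d(2)] by blast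
  obtain w where w: "w \<in> ideal_of L z" "s \<epsilon> = Some w"
    using translation_ideal[OF ts(1) d(4) e(3)] by blast
  then have "t \<epsilon> = Some w"
    using translation_agree[OF ts \<gamma>(2,3) e(2)] by auto
  then show "\<alpha> \<in> push t F"
    unfolding push_def using d(1) e(1) ideal_trans[OF d(1,3) w(1)] by blast
qed

text \<open>An idempotent that witnesses equality of germs meets \<open>F\<close> together with
  \<open>dom s\<close>, and any point of \<open>F\<close> in both domains will do; conversely the
  identity of \<open>\<gamma>\<Lambda>\<close> is such an idempotent.\<close>

lemma germ_rel_path_action:
  "((s, F), (t, G)) \<in> germ_rel (path_action L) \<longleftrightarrow>
     s \<in> cat_isg L \<and> t \<in> cat_isg L \<and> F \<in> tight_paths L \<and> G = F \<and>
     (\<exists>\<gamma>\<in>F. \<exists>y. s \<gamma> = Some y \<and> t \<gamma> = Some y)" (is "?l \<longleftrightarrow> ?r")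
proof
  assume ?l
  then have st: "s \<in> cat_isg L" "t \<in> cat_isg L" "F \<in> adom (path_action L) s" "G = F"
    and "\<exists>e\<in>cat_isg L. e \<circ>\<^sub>m e = e \<and> F \<in> adom (path_action L) e \<and> s \<circ>\<^sub>m e = t \<circ>\<^sub>m e"
    unfolding germ_rel_def path_action_simps by auto
  then obtain e where e: "e \<in> cat_idem L" "F \<in> adom (path_action L) e" "s \<circ>\<^sub>m e = t \<circ>\<^sub>m e"
    unfolding cat_idem_def by blast
  have F: "F \<in> tight_paths L" "F \<inter> dom s \<noteq> {}" "F \<inter> dom e \<noteq> {}"
    using st e adom_path_action idem_isg by auto
  obtain \<gamma> where \<gamma>: "\<gamma> \<in> F" "\<gamma> \<in> dom s" "\<gamma> \<in> dom e"
    using path_meets_inter[OF tight_path[OF F(1)] st(1) idem_isg[OF e(1)] F(2,3)] by blast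
  then obtain y where y: "s \<gamma> = Some y" by blast
  have "e \<gamma> = Some \<gamma>" using \<gamma>(3) fun_cong[OF idem_eq[OF e(1)], of \<gamma>] by (simp add: restrict_map_def)
  then have "t \<gamma> = Some y" using y fun_cong[OF e(3), of \<gamma>] by (simp add: map_comp_def)
  then show ?r using st F \<gamma> y by blast
next
  assume ?r
  then obtain \<gamma> y where st: "s \<in> cat_isg L" "t \<in> cat_isg L" "F \<in> tight_paths L" "G = F"
    and \<gamma>: "\<gamma> \<in> F" "s \<gamma> = Some y" "t \<gamma> = Some y" by blast
  have g: "\<gamma> \<in> mor L" using \<gamma> st tight_path path_mor by blast
  let ?e = "range_idem L \<gamma>"
  note e = range_idem_in[OF g] dom_range_idem[OF g]
  have "(s \<circ>\<^sub>m ?e) x = (t \<circ>\<^sub>m ?e) x" for x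
  proof (cases "x \<in> ideal_of L \<gamma>")
    case True
    then have "s x = t x"
      using translation_agree[OF cat_isg_translation[OF st(1)] cat_isg_translation[OF st(2)] \<gamma>(2,3)]
      by fastforce
    moreover have "?e x = Some x"
      using True e fun_cong[OF idem_eq[OF e(1)], of x] by (simp add: restrict_map_def)
    ultimately show ?thesis by (simp add: map_comp_def)
  next
    case False
    then have "?e x = None" using e(2) by blast
    then show ?thesis by (simp add: map_comp_def)
  qed
  then have "s \<circ>\<^sub>m ?e = t \<circ>\<^sub>m ?e" by blast
  moreover have "?e \<circ>\<^sub>m ?e = ?e" "?e \<in> cat_isg L" using e(1) unfolding cat_idem_def by auto
  moreover have "F \<in> adom (path_action L) s" "F \<in> adom (path_action L) t" "F \<in> adom (path_action L) ?e"
    using st \<gamma> adom_path_action idem_isg[OF e(1)] e(2) ideal_self[OF g] by auto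
  ultimately show ?l unfolding germ_rel_def path_action_simps using st by auto
qed

lemma path_agree_trans:
  assumes F: "F \<in> path_space_set L"
    and st: "s \<in> cat_isg L" "t \<in> cat_isg L" "u \<in> cat_isg L"
    and 1: "\<gamma> \<in> F" "s \<gamma> = Some y" "t \<gamma> = Some y" and 2: "\<delta> \<in> F" "t \<delta> = Some z" "u \<delta> = Some z"
  shows "\<exists>\<gamma>\<in>F. \<exists>y. s \<gamma> = Some y \<and> u \<gamma> = Some y"
proof -
  note ts = cat_isg_translation[OF st(1)] cat_isg_translation[OF st(2)] cat_isg_translation[OF st(3)]
  obtain \<epsilon> where e: "\<epsilon> \<in> F" "\<epsilon> \<in> ideal_of L \<gamma>" "\<epsilon> \<in> ideal_of L \<delta>"
    using path_directed[OF F 1(1) 2(1)] by blast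
  obtain w where w: "s \<epsilon> = Some w" "t \<epsilon> = Some w"
    using translation_agree[OF ts(1,2) 1(2,3) e(2)] by blast
  moreover have "u \<epsilon> = Some w"
    using translation_agree[OF ts(2,3) 2(2,3) e(3)] w(2) by auto
  ultimately show ?thesis using e(1) by blast
qed

lemma germ_rel_path_trans:
  assumes "((s, F), (t, F)) \<in> germ_rel (path_action L)" "((t, F), (u, F)) \<in> germ_rel (path_action L)"
  shows "((s, F), (u, F)) \<in> germ_rel (path_action L)"
  using assms path_agree_trans[OF tight_path] unfolding germ_rel_path_action by blast

text \<open>Off the tight paths both germs are the empty set, so the equality holds there as well.
  Germs of inverses at \<open>push t F\<close> can thus be compared before that path is known to be
  tight.\<close>

lemma germ_path_eqI:
  assumes st: "s \<in> cat_isg L" "t \<in> cat_isg L" and \<gamma>: "\<gamma> \<in> F" "s \<gamma> = Some y" "t \<gamma> = Some y"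
  shows "germ (path_action L) s F = germ (path_action L) t F"
proof -
  have "((s, F), (u, G)) \<in> germ_rel (path_action L) \<longleftrightarrow> ((t, F), (u, G)) \<in> germ_rel (path_action L)" for u G
  proof (cases "F \<in> tight_paths L \<and> G = F")
    case True
    then have "((s, F), (t, F)) \<in> germ_rel (path_action L)" "((t, F), (s, F)) \<in> germ_rel (path_action L)"
      using st \<gamma> unfolding germ_rel_path_action by blast+
    then show ?thesis using True germ_rel_path_trans by blast
  next
    case False then show ?thesis unfolding germ_rel_path_action by blast
  qed
  then show ?thesis unfolding germ_def by auto
qed

lemma germ_action_path_action: "germ_action (path_action L)"
proof
  fix s F assume "s \<in> isg (path_action L)" "F \<in> adom (path_action L) s"
  then show "((s, F), (s, F)) \<in> germ_rel (path_action L)"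
    unfolding germ_rel_path_action path_action_simps using adom_path_action by blast
next
  fix s t u F assume "((s, F), (t, F)) \<in> germ_rel (path_action L)" "((t, F), (u, F)) \<in> germ_rel (path_action L)"
  then show "((s, F), (u, F)) \<in> germ_rel (path_action L)" by (rule germ_rel_path_trans)
next
  fix s t F assume "((s, F), (t, F)) \<in> germ_rel (path_action L)"
  then obtain \<gamma> y where st: "s \<in> cat_isg L" "t \<in> cat_isg L" and F: "F \<in> tight_paths L"
    and \<gamma>: "\<gamma> \<in> F" "s \<gamma> = Some y" "t \<gamma> = Some y" unfolding germ_rel_path_action by blast
  note P = tight_path[OF F]
  have acts: "act (path_action L) s F = push s F" "act (path_action L) t F = push t F"
    using act_path_action P st \<gamma> by blast+
  have push: "push s F = push t F"
    using push_agree[OF st P \<gamma>] push_agree[OF st(2,1) P \<gamma>(1,3,2)] by blast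
  show "act (path_action L) s F = act (path_action L) t F" using acts push by simp
  \<comment> \<open>The common value lies in the moved path, and both inverses send it back to
    \<gamma>.\<close>
  have "y \<in> push t F" using push_memI st \<gamma> by blast
  moreover have "pinverse s y = Some \<gamma>" "pinverse t y = Some \<gamma>"
    using pinverse_translation cat_isg_translation st \<gamma> by blast+
  ultimately show "germ (path_action L) (istar (path_action L) s) (act (path_action L) s F)
      = germ (path_action L) (istar (path_action L) t) (act (path_action L) t F)"
    unfolding acts push path_action_simps using st by (intro germ_path_eqI cat_isg.inverse)
next
  fix s s' t t' F
  assume ss: "((s, act (path_action L) t F), (s', act (path_action L) t F)) \<in> germ_rel (path_action L)"
    and "((t, F), (t', F)) \<in> germ_rel (path_action L)"
  then obtain \<gamma> y where tt: "t \<in> cat_isg L" "t' \<in> cat_isg L" and F: "F \<in> tight_paths L"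
    and \<gamma>: "\<gamma> \<in> F" "t \<gamma> = Some y" "t' \<gamma> = Some y" unfolding germ_rel_path_action by blast
  note P = tight_path[OF F]
  have acts: "act (path_action L) t F = push t F"
    using act_path_action P tt \<gamma> by blast
  obtain \<beta> z where st: "s \<in> cat_isg L" "s' \<in> cat_isg L"
    and b: "\<beta> \<in> push t F" "s \<beta> = Some z" "s' \<beta> = Some z"
    using ss unfolding acts germ_rel_path_action by blast
  \<comment> \<open>Here \<beta> is only an initial segment of some value of \<open>t\<close>, so
    agreement of \<open>s\<close> and \<open>s'\<close> at \<beta> must be moved up: a common
    extension \<epsilon> of \<gamma> and \<delta> has the same value \<open>w\<close> under
    \<open>t\<close> and \<open>t'\<close>, and \<open>w\<close> extends \<beta>.\<close>
  obtain \<delta> x where d: "\<delta> \<in> F" "x \<in> ideal_of L \<beta>" "t \<delta> = Some x" "\<beta> \<in> mor L"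
    using b(1) unfolding push_def by blast
  obtain \<epsilon> where e: "\<epsilon> \<in> F" "\<epsilon> \<in> ideal_of L \<gamma>" "\<epsilon> \<in> ideal_of L \<delta>"
    using path_directed[OF P \<gamma>(1) d(1)] by blast
  obtain w where w: "t \<epsilon> = Some w" "t' \<epsilon> = Some w"
    using translation_agree[OF cat_isg_translation[OF tt(1)] cat_isg_translation[OF tt(2)] \<gamma>(2,3) e(2)]
    by blast
  have "w \<in> ideal_of L x"
    using translation_ideal[OF cat_isg_translation[OF tt(1)] d(3) e(3)] w(1) by auto
  then have "w \<in> ideal_of L \<beta>" using ideal_trans d by blast
  then obtain v where "s w = Some v" "s' w = Some v"
    using translation_agree[OF cat_isg_translation[OF st(1)] cat_isg_translation[OF st(2)] b(2,3)]
    by blast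
  then have "(s \<circ>\<^sub>m t) \<epsilon> = Some v" "(s' \<circ>\<^sub>m t') \<epsilon> = Some v" using w by (auto simp: map_comp_Some_iff)
  then show "germ (path_action L) (imul (path_action L) s t) F
      = germ (path_action L) (imul (path_action L) s' t') F"
    unfolding path_action_simps using st tt e(1) by (intro germ_path_eqI cat_isg.mult)
qed


section \<open>Filters and paths\<close>


definition path_filter :: "'a set \<Rightarrow> ('a \<rightharpoonup> 'a) set" where
  "path_filter F = {e \<in> cat_idem L. dom e \<inter> F \<noteq> {}}"

definition filter_path :: "('a \<rightharpoonup> 'a) set \<Rightarrow> 'a set" where
  "filter_path \<eta> = {\<alpha> \<in> mor L. range_idem L \<alpha> \<in> \<eta>}"

text \<open>Primeness for unions of ideals, phrased without generators: every \<gamma> in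
  \<open>dom e\<close> extends one of the finitely many generators, whose idempotent is then in the
  filter by upward closure.\<close>

definition prime_filter :: "('a \<rightharpoonup> 'a) set \<Rightarrow> bool" where
  "prime_filter \<eta> \<longleftrightarrow> is_filter L \<eta> \<and> (\<forall>e\<in>\<eta>. \<exists>\<gamma>\<in>dom e. range_idem L \<gamma> \<in> \<eta>)"

lemma
  assumes fil: "is_filter L \<eta>"
  shows filter_nonempty: "\<eta> \<noteq> {}" and filter_idem: "e \<in> \<eta> \<Longrightarrow> e \<in> cat_idem L"
    and filter_inter: "e \<in> \<eta> \<Longrightarrow> f \<in> \<eta> \<Longrightarrow> e \<circ>\<^sub>m f \<in> \<eta>"
  using fil unfolding is_filter_def by blast+

lemma filter_dom: "is_filter L \<eta> \<Longrightarrow> e \<in> \<eta> \<Longrightarrow> dom e \<noteq> {}"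
  unfolding is_filter_def dom_eq_empty_conv by blast

lemma filter_up:
  assumes "is_filter L \<eta>" "e \<in> \<eta>" "f \<in> cat_idem L" "dom e \<subseteq> dom f"
  shows "f \<in> \<eta>"
proof -
  have "idem_le e f" using idem_le_iff[OF filter_idem[OF assms(1,2)] assms(3)] assms(4) by simp
  then show ?thesis using assms unfolding is_filter_def by blast
qed

lemma filter_meet:
  assumes "is_filter L \<eta>" "e \<in> \<eta>" "f \<in> \<eta>"
  shows "dom e \<inter> dom f \<noteq> {}"
  using filter_dom[OF assms(1) filter_inter[OF assms]]
  by (simp only: idem_comp(2)[OF filter_idem[OF assms(1,2)] filter_idem[OF assms(1,3)]] not_False_eq_True)

lemma is_filterI:
  assumes "\<eta> \<noteq> {}" "\<eta> \<subseteq> cat_idem L" "\<And>e. e \<in> \<eta> \<Longrightarrow> dom e \<noteq> {}"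
    and "\<And>e f. e \<in> \<eta> \<Longrightarrow> f \<in> cat_idem L \<Longrightarrow> dom e \<subseteq> dom f \<Longrightarrow> f \<in> \<eta>"
    and "\<And>e f. e \<in> \<eta> \<Longrightarrow> f \<in> \<eta> \<Longrightarrow> e \<circ>\<^sub>m f \<in> \<eta>"
  shows "is_filter L \<eta>"
  unfolding is_filter_def
proof (intro conjI ballI impI)
  show "Map.empty \<notin> \<eta>" using assms(3)[of Map.empty] by auto
  fix e f assume "e \<in> \<eta>" "f \<in> cat_idem L" "idem_le e f"
  then show "f \<in> \<eta>" using assms(2,4) idem_le_iff by blast
qed (use assms in auto)

lemma range_idem_dom_subset:
  assumes "e \<in> cat_idem L" "\<gamma> \<in> dom e"
  shows "dom (range_idem L \<gamma>) \<subseteq> dom e"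
  using dom_ideal[OF idem_isg[OF assms(1)] assms(2)]
  by (auto simp only: dom_range_idem[OF dom_mor[OF idem_isg[OF assms(1)] assms(2)]])

lemma filter_range_idem_up:
  "is_filter L \<eta> \<Longrightarrow> range_idem L \<gamma> \<in> \<eta> \<Longrightarrow> e \<in> cat_idem L \<Longrightarrow> \<gamma> \<in> dom e \<Longrightarrow> e \<in> \<eta>"
  by (rule filter_up[OF _ _ _ range_idem_dom_subset])

text \<open>By heredity \<open>F\<close> meets the ideal of \<alpha> only if \<alpha> is in
  \<open>F\<close>; conversely \<alpha> lies in its own ideal.\<close>

lemma filter_path_path_filter:
  assumes F: "F \<in> path_space_set L" shows "filter_path (path_filter F) = F"
proof (intro set_eqI iffI)
  fix \<alpha> assume "\<alpha> \<in> filter_path (path_filter F)"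
  then show "\<alpha> \<in> F"
    unfolding filter_path_def path_filter_def using dom_range_idem path_hereditary[OF F] by blast
next
  fix \<alpha> assume "\<alpha> \<in> F"
  then show "\<alpha> \<in> filter_path (path_filter F)"
    unfolding filter_path_def path_filter_def
    using path_mor[OF F] range_idem_in dom_range_idem ideal_self by blast
qed

lemma is_filter_path_filter:
  assumes F: "F \<in> path_space_set L" shows "is_filter L (path_filter F)"
proof (rule is_filterI)
  obtain \<alpha> where "\<alpha> \<in> F" using F unfolding path_space_set_def by blast
  then have "range_idem L \<alpha> \<in> path_filter F"
    using filter_path_path_filter[OF F] unfolding filter_path_def by blast
  then show "path_filter F \<noteq> {}" by blast
next
  fix e f assume "e \<in> path_filter F" "f \<in> path_filter F"
  then have ef: "e \<in> cat_idem L" "f \<in> cat_idem L" "F \<inter> dom e \<noteq> {}" "F \<inter> dom f \<noteq> {}"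
    unfolding path_filter_def by auto
  then have "F \<inter> (dom e \<inter> dom f) \<noteq> {}"
    using path_meets_inter[OF F] idem_isg by blast
  then show "e \<circ>\<^sub>m f \<in> path_filter F"
    unfolding path_filter_def using idem_comp[OF ef(1,2)] by blast
qed (auto simp: path_filter_def)

lemma prime_filter_mem:
  assumes "prime_filter \<eta>" "e \<in> cat_idem L"
  shows "e \<in> \<eta> \<longleftrightarrow> dom e \<inter> filter_path \<eta> \<noteq> {}"
proof
  assume "e \<in> \<eta>"
  then obtain \<gamma> where "\<gamma> \<in> dom e" "range_idem L \<gamma> \<in> \<eta>" using assms unfolding prime_filter_def by blast
  then show "dom e \<inter> filter_path \<eta> \<noteq> {}"
    unfolding filter_path_def using dom_mor idem_isg assms(2) by blast
next
  assume "dom e \<inter> filter_path \<eta> \<noteq> {}"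
  then show "e \<in> \<eta>"
    unfolding filter_path_def using filter_range_idem_up assms unfolding prime_filter_def by blast
qed

lemma path_filter_filter_path:
  assumes "prime_filter \<eta>" shows "path_filter (filter_path \<eta>) = \<eta>"
proof -
  have "\<eta> \<subseteq> cat_idem L" using assms filter_idem unfolding prime_filter_def by auto
  then show ?thesis unfolding path_filter_def using prime_filter_mem[OF assms] by auto
qed

text \<open>Directedness is primeness applied to a product of two range idempotents, whose domain is
  the intersection of the ideals; heredity is upward closure.\<close>

lemma filter_path_path:
  assumes \<eta>: "prime_filter \<eta>" shows "filter_path \<eta> \<in> path_space_set L"
proof -
  have fil: "is_filter L \<eta>" using \<eta> unfolding prime_filter_def by blast
  have "filter_path \<eta> \<noteq> {}"
    using filter_nonempty[OF fil] prime_filter_mem[OF \<eta>] filter_idem[OF fil] by blast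
  moreover have "\<alpha> \<in> filter_path \<eta>" if "\<beta> \<in> filter_path \<eta>" "\<alpha> \<in> mor L" "\<beta> \<in> ideal_of L \<alpha>" for \<alpha> \<beta>
    using that filter_range_idem_up[OF fil] range_idem_in dom_range_idem
    unfolding filter_path_def by blast
  moreover have "\<exists>\<gamma>\<in>filter_path \<eta>. \<gamma> \<in> ideal_of L \<alpha> \<and> \<gamma> \<in> ideal_of L \<beta>"
    if ab: "\<alpha> \<in> filter_path \<eta>" "\<beta> \<in> filter_path \<eta>" for \<alpha> \<beta>
  proof -
    have m: "\<alpha> \<in> mor L" "\<beta> \<in> mor L" using ab unfolding filter_path_def by auto
    let ?e = "range_idem L \<alpha> \<circ>\<^sub>m range_idem L \<beta>"
    have "?e \<in> \<eta>" using filter_inter[OF fil] ab unfolding filter_path_def by blast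
    then have "dom ?e \<inter> filter_path \<eta> \<noteq> {}" using prime_filter_mem[OF \<eta>] filter_idem[OF fil] by blast
    then show ?thesis
      unfolding idem_comp(2)[OF range_idem_in[OF m(1)] range_idem_in[OF m(2)]]
        dom_range_idem[OF m(1)] dom_range_idem[OF m(2)] by blast
  qed
  ultimately show ?thesis
    unfolding path_space_set_def path_le_def by (auto simp: filter_path_def)
qed


section \<open>Ultrafilters and tightness\<close>

text \<open>Zorn's lemma among the filters that contain the idempotent of \<gamma>. The idempotents
  with \<gamma> in their domain show that such filters exist.\<close>

lemma ultrafilter_exists:
  assumes \<gamma>: "\<gamma> \<in> mor L"
  shows "\<exists>\<xi>. is_ultrafilter L \<xi> \<and> range_idem L \<gamma> \<in> \<xi>"
proof -
  define \<A> where "\<A> = {\<xi>. is_filter L \<xi> \<and> range_idem L \<gamma> \<in> \<xi>}"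
  have g: "range_idem L \<gamma> \<in> {e \<in> cat_idem L. \<gamma> \<in> dom e}"
    using range_idem_in[OF \<gamma>] dom_range_idem[OF \<gamma>] ideal_self[OF \<gamma>] by blast
  have "is_filter L {e \<in> cat_idem L. \<gamma> \<in> dom e}"
  proof (rule is_filterI)
    show "{e \<in> cat_idem L. \<gamma> \<in> dom e} \<noteq> {}" using g by blast
    show "e \<circ>\<^sub>m f \<in> {e \<in> cat_idem L. \<gamma> \<in> dom e}"
      if "e \<in> {e \<in> cat_idem L. \<gamma> \<in> dom e}" "f \<in> {e \<in> cat_idem L. \<gamma> \<in> dom e}" for e f
      using that idem_comp by blast
  qed blast+
  then have "\<A> \<noteq> {}" using g unfolding \<A>_def by blast
  moreover have "\<Union>\<C> \<in> \<A>" if "\<C> \<noteq> {}" and chain: "subset.chain \<A> \<C>" for \<C>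
  proof -
    have C: "is_filter L \<xi>" "range_idem L \<gamma> \<in> \<xi>" if "\<xi> \<in> \<C>" for \<xi>
      using chain that unfolding subset.chain_def \<A>_def by auto
    have "is_filter L (\<Union>\<C>)"
    proof (rule is_filterI)
      show "\<Union>\<C> \<noteq> {}" using C(2) \<open>\<C> \<noteq> {}\<close> by auto
      show "\<Union>\<C> \<subseteq> cat_idem L" using filter_idem[OF C(1)] by auto
      show "dom e \<noteq> {}" if "e \<in> \<Union>\<C>" for e using that filter_dom[OF C(1)] by auto
      show "f \<in> \<Union>\<C>" if ef: "e \<in> \<Union>\<C>" "f \<in> cat_idem L" "dom e \<subseteq> dom f" for e f
      proof -
        obtain \<xi> where x: "\<xi> \<in> \<C>" "e \<in> \<xi>" using ef(1) by (rule UnionE)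
        show ?thesis using UnionI[OF x(1) filter_up[OF C(1)[OF x(1)] x(2) ef(2,3)]] .
      qed
      show "e \<circ>\<^sub>m f \<in> \<Union>\<C>" if "e \<in> \<Union>\<C>" "f \<in> \<Union>\<C>" for e f
      proof -
        obtain \<xi> \<zeta> where *: "\<xi> \<in> \<C>" "e \<in> \<xi>" "\<zeta> \<in> \<C>" "f \<in> \<zeta>" using \<open>e \<in> \<Union>\<C>\<close> \<open>f \<in> \<Union>\<C>\<close> by auto
        then have "\<xi> \<subseteq> \<zeta> \<or> \<zeta> \<subseteq> \<xi>" using chain unfolding subset_chain_def by auto
        then obtain \<omega> where w: "\<omega> \<in> \<C>" "e \<in> \<omega>" "f \<in> \<omega>" using * by auto
        show ?thesis using UnionI[OF w(1) filter_inter[OF C(1)[OF w(1)] w(2,3)]] .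
      qed
    qed
    then show ?thesis using C \<open>\<C> \<noteq> {}\<close> unfolding \<A>_def by blast
  qed
  ultimately obtain \<xi> where "\<xi> \<in> \<A>" "\<forall>\<zeta>\<in>\<A>. \<xi> \<subseteq> \<zeta> \<longrightarrow> \<zeta> = \<xi>"
    using subset_Zorn_nonempty by blast
  then show ?thesis unfolding \<A>_def is_ultrafilter_def by blast
qed

lemma ultrafilter_is_filter: "is_ultrafilter L \<xi> \<Longrightarrow> is_filter L \<xi>"
  unfolding is_ultrafilter_def by blast

text \<open>Otherwise the idempotents whose domain contains some \<open>dom e \<inter> dom f\<close>
  with \<open>e \<in> \<xi>\<close> would form a strictly larger filter. Maximality turns omission
  into a positive witness.\<close>

lemma ultrafilter_disjoint:
  assumes \<xi>: "is_ultrafilter L \<xi>" and f: "f \<in> cat_idem L" "f \<notin> \<xi>"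
  shows "\<exists>e\<in>\<xi>. dom e \<inter> dom f = {}"
proof (rule ccontr)
  assume meet: "\<not> (\<exists>e\<in>\<xi>. dom e \<inter> dom f = {})"
  have fil: "is_filter L \<xi>" using \<xi> ultrafilter_is_filter by simp
  define \<zeta> where "\<zeta> = {g \<in> cat_idem L. \<exists>e\<in>\<xi>. dom e \<inter> dom f \<subseteq> dom g}"
  have "is_filter L \<zeta>"
  proof (rule is_filterI)
    show "\<zeta> \<noteq> {}" unfolding \<zeta>_def using f(1) filter_nonempty[OF fil] by blast
    show "dom g \<noteq> {}" if "g \<in> \<zeta>" for g using that meet unfolding \<zeta>_def by blast
    show "g \<circ>\<^sub>m h \<in> \<zeta>" if "g \<in> \<zeta>" "h \<in> \<zeta>" for g h
    proof -
      obtain d e where gh: "g \<in> cat_idem L" "h \<in> cat_idem L" and de: "d \<in> \<xi>" "e \<in> \<xi>"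
        "dom d \<inter> dom f \<subseteq> dom g" "dom e \<inter> dom f \<subseteq> dom h"
        using \<open>g \<in> \<zeta>\<close> \<open>h \<in> \<zeta>\<close> unfolding \<zeta>_def by blast
      have "dom (d \<circ>\<^sub>m e) = dom d \<inter> dom e" "d \<circ>\<^sub>m e \<in> \<xi>"
        using idem_comp filter_idem[OF fil] filter_inter[OF fil] de by auto
      then have "d \<circ>\<^sub>m e \<in> \<xi> \<and> dom (d \<circ>\<^sub>m e) \<inter> dom f \<subseteq> dom (g \<circ>\<^sub>m h)"
        using de(3,4) idem_comp(2)[OF gh] by auto
      then show ?thesis unfolding \<zeta>_def using idem_comp(1)[OF gh] by auto
    qed
    show "h \<in> \<zeta>" if gh: "g \<in> \<zeta>" "h \<in> cat_idem L" "dom g \<subseteq> dom h" for g h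
    proof -
      obtain e where "e \<in> \<xi>" "dom e \<inter> dom f \<subseteq> dom g" using gh(1) unfolding \<zeta>_def by blast
      then have "\<exists>e\<in>\<xi>. dom e \<inter> dom f \<subseteq> dom h" using gh(3) subset_trans by metis
      then show ?thesis using gh(2) unfolding \<zeta>_def by simp
    qed
  qed (auto simp: \<zeta>_def)
  moreover have "\<xi> \<subseteq> \<zeta>" unfolding \<zeta>_def using filter_idem[OF fil] by blast
  ultimately have "\<zeta> = \<xi>" using \<xi> unfolding is_ultrafilter_def by blast
  moreover have "f \<in> \<zeta>" unfolding \<zeta>_def using f(1) filter_nonempty[OF fil] by blast
  ultimately show False using f(2) by blast
qed

text \<open>The product of the individual witnesses is disjoint from all the ideals at once.\<close>

lemma ultrafilter_disjoint_finite:
  assumes \<xi>: "is_ultrafilter L \<xi>" and "finite B" "B \<subseteq> mor L" "\<And>\<beta>. \<beta> \<in> B \<Longrightarrow> range_idem L \<beta> \<notin> \<xi>"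
  shows "\<exists>e\<in>\<xi>. \<forall>\<beta>\<in>B. dom e \<inter> ideal_of L \<beta> = {}"
  using assms(2-4)
proof (induction B rule: finite_induct)
  case empty
  then show ?case using \<xi> filter_nonempty unfolding is_ultrafilter_def by blast
next
  case (insert \<beta> B)
  have fil: "is_filter L \<xi>" using \<xi> ultrafilter_is_filter by simp
  obtain e where e: "e \<in> \<xi>" "\<forall>\<beta>\<in>B. dom e \<inter> ideal_of L \<beta> = {}" using insert by auto
  have b: "\<beta> \<in> mor L" using insert by blast
  obtain f where f: "f \<in> \<xi>" "dom f \<inter> ideal_of L \<beta> = {}"
    using ultrafilter_disjoint[OF \<xi> range_idem_in[OF b]] insert dom_range_idem[OF b] by auto
  have "dom (e \<circ>\<^sub>m f) = dom e \<inter> dom f" "e \<circ>\<^sub>m f \<in> \<xi>"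
    using idem_comp filter_idem[OF fil] filter_inter[OF fil] e f by auto
  then show ?case using e f by blast
qed

section \<open>The two topologies and the closure of the ultrafilters\<close>

lemma filter_space_basic_open:
  "finite X \<Longrightarrow> X \<subseteq> cat_idem L \<Longrightarrow> finite Y \<Longrightarrow> Y \<subseteq> cat_idem L \<Longrightarrow>
    openin (filter_space L) {\<eta>. is_filter L \<eta> \<and> X \<subseteq> \<eta> \<and> Y \<inter> \<eta> = {}}"
  unfolding filter_space_def by (rule topology_generated_by_Basis, rule CollectI, rule exI[of _ X], rule exI[of _ Y]) simp

lemma path_space_basic_open:
  "finite X \<Longrightarrow> X \<subseteq> mor L \<Longrightarrow> finite Y \<Longrightarrow> Y \<subseteq> mor L \<Longrightarrow>
    openin (path_space L) {F \<in> path_space_set L. X \<subseteq> F \<and> Y \<inter> F = {}}"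
  unfolding path_space_def by (rule topology_generated_by_Basis, rule CollectI, rule exI[of _ X], rule exI[of _ Y]) simp

lemma topspace_filter_space: "topspace (filter_space L) = {\<eta>. is_filter L \<eta>}"
proof
  show "topspace (filter_space L) \<subseteq> {\<eta>. is_filter L \<eta>}" unfolding filter_space_def by auto
  show "{\<eta>. is_filter L \<eta>} \<subseteq> topspace (filter_space L)"
    using openin_subset[OF filter_space_basic_open[of "{}" "{}"]] by simp
qed

lemma topspace_path_space: "topspace (path_space L) = path_space_set L"
proof
  show "topspace (path_space L) \<subseteq> path_space_set L" unfolding path_space_def by auto
  show "path_space_set L \<subseteq> topspace (path_space L)"
    using openin_subset[OF path_space_basic_open[of "{}" "{}"]] by simp
qed

lemma tight_filter_is_filter: "\<eta> \<in> tight_filters L \<Longrightarrow> is_filter L \<eta>"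
  using closure_of_subset_topspace[of "filter_space L"]
  unfolding tight_filters_def topspace_filter_space by auto

lemma tight_filter_approx:
  assumes "\<eta> \<in> tight_filters L" "finite X" "X \<subseteq> \<eta>" "finite Y" "Y \<subseteq> cat_idem L" "Y \<inter> \<eta> = {}"
  shows "\<exists>\<xi>. is_ultrafilter L \<xi> \<and> X \<subseteq> \<xi> \<and> Y \<inter> \<xi> = {}"
proof -
  have fil: "is_filter L \<eta>" using assms(1) by (rule tight_filter_is_filter)
  let ?U = "{\<eta>. is_filter L \<eta> \<and> X \<subseteq> \<eta> \<and> Y \<inter> \<eta> = {}}"
  have "X \<subseteq> cat_idem L" using filter_idem[OF fil] assms(3) by blast
  then have "openin (filter_space L) ?U" using filter_space_basic_open assms(2,4,5) by blast
  moreover have "\<eta> \<in> ?U" using fil assms(3,6) by blast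
  ultimately have "\<exists>\<xi>. \<xi> \<in> {\<eta>. is_ultrafilter L \<eta>} \<and> \<xi> \<in> ?U"
    using assms(1) unfolding tight_filters_def in_closure_of by meson
  then show ?thesis by auto
qed

text \<open>Finitely many conditions record a failure of primeness: \<open>e\<close> inside, the
  generators of \<open>dom e\<close> outside. An ultrafilter satisfying them contains an idempotent
  disjoint from all generators, hence from \<open>dom e\<close>, which is impossible.\<close>

lemma tight_filter_prime:
  assumes \<eta>: "\<eta> \<in> tight_filters L" shows "prime_filter \<eta>"
proof -
  have fil: "is_filter L \<eta>" using \<eta> by (rule tight_filter_is_filter)
  have "\<exists>\<gamma>\<in>dom e. range_idem L \<gamma> \<in> \<eta>" if e: "e \<in> \<eta>" for e
  proof (rule ccontr)
    assume none: "\<not> (\<exists>\<gamma>\<in>dom e. range_idem L \<gamma> \<in> \<eta>)"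
    obtain \<Gamma> where G: "finite \<Gamma>" "\<Gamma> \<subseteq> mor L" "dom e = (\<Union>\<gamma>\<in>\<Gamma>. ideal_of L \<gamma>)"
      using finitely_generated_dom[OF idem_isg[OF filter_idem[OF fil e]]]
      unfolding finitely_generated_def by blast
    have notin: "range_idem L \<gamma> \<notin> \<eta>" if "\<gamma> \<in> \<Gamma>" for \<gamma>
    proof -
      have "\<gamma> \<in> dom e" unfolding G(3) using that G(2) ideal_self by auto
      then show ?thesis using none by simp
    qed
    have "range_idem L ` \<Gamma> \<inter> \<eta> = {}" "range_idem L ` \<Gamma> \<subseteq> cat_idem L"
      using notin G(2) range_idem_in by auto
    then obtain \<xi> where \<xi>: "is_ultrafilter L \<xi>" "e \<in> \<xi>" "range_idem L ` \<Gamma> \<inter> \<xi> = {}"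
      using tight_filter_approx[OF \<eta>, of "{e}" "range_idem L ` \<Gamma>"] e G(1) by auto
    have "range_idem L \<gamma> \<notin> \<xi>" if "\<gamma> \<in> \<Gamma>" for \<gamma> using \<xi>(3) that by blast
    then obtain d where d: "d \<in> \<xi>" "\<forall>\<gamma>\<in>\<Gamma>. dom d \<inter> ideal_of L \<gamma> = {}"
      using ultrafilter_disjoint_finite[OF \<xi>(1) G(1,2)] by blast
    have "dom e \<inter> dom d \<noteq> {}"
      using filter_meet[OF ultrafilter_is_filter[OF \<xi>(1)] \<xi>(2) d(1)] .
    then show False using d(2) G(3) by blast
  qed
  then show ?thesis unfolding prime_filter_def using fil by blast
qed

text \<open>If the path missed \<open>Z\<close>, some ultrafilter would contain the idempotent of
  \<alpha> and omit those of \<open>B\<close> and \<open>Z\<close>, hence contain a \<open>d\<close>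
  disjoint from all their ideals. A point of \<open>dom d\<close> in the ideal of \<alpha> then
  refutes exhaustiveness of \<open>Z\<close>, as \<open>dom d\<close> is closed under
  extension.\<close>

lemma tight_filter_path:
  assumes \<eta>: "\<eta> \<in> tight_filters L" shows "filter_path \<eta> \<in> tight_paths L"
  unfolding tight_paths_def
proof (intro CollectI conjI ballI allI impI)
  show "filter_path \<eta> \<in> path_space_set L" by (intro filter_path_path tight_filter_prime \<eta>)
next
  fix \<alpha> B Z
  assume a: "\<alpha> \<in> filter_path \<eta>" and B: "finite B" "B \<subseteq> mor L" "B \<inter> filter_path \<eta> = {}"
    and Z: "finite Z" "Z \<subseteq> ideal_of L \<alpha> - (\<Union>\<beta>\<in>B. ideal_of L \<beta>)"
    and exh: "\<forall>\<gamma>\<in>ideal_of L \<alpha> - (\<Union>\<beta>\<in>B. ideal_of L \<beta>). \<exists>z\<in>Z. meets L \<gamma> z"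
  have am: "\<alpha> \<in> mor L" "range_idem L \<alpha> \<in> \<eta>" using a unfolding filter_path_def by auto
  have Zm: "Z \<subseteq> mor L" using Z(2) ideal_mor[OF am(1)] by blast
  show "filter_path \<eta> \<inter> Z \<noteq> {}"
  proof
    assume "filter_path \<eta> \<inter> Z = {}"
    then have "range_idem L ` (B \<union> Z) \<inter> \<eta> = {}" using B Zm unfolding filter_path_def by blast
    moreover have "range_idem L ` (B \<union> Z) \<subseteq> cat_idem L" using B(2) Zm range_idem_in by blast
    ultimately obtain \<xi> where \<xi>: "is_ultrafilter L \<xi>" "range_idem L \<alpha> \<in> \<xi>" "range_idem L ` (B \<union> Z) \<inter> \<xi> = {}"
      using tight_filter_approx[OF \<eta>, of "{range_idem L \<alpha>}" "range_idem L ` (B \<union> Z)"]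
        am(2) finite_imageI[OF finite_UnI[OF B(1) Z(1)]] by blast
    have BZ: "finite (B \<union> Z)" "B \<union> Z \<subseteq> mor L" using B(1,2) Z(1) Zm by auto
    have "range_idem L \<gamma> \<notin> \<xi>" if "\<gamma> \<in> B \<union> Z" for \<gamma> using \<xi>(3) that by blast
    then have "\<exists>d\<in>\<xi>. \<forall>\<gamma>\<in>B \<union> Z. dom d \<inter> ideal_of L \<gamma> = {}"
      by (rule ultrafilter_disjoint_finite[OF \<xi>(1) BZ])
    then obtain d where d: "d \<in> \<xi>" "\<forall>\<gamma>\<in>B \<union> Z. dom d \<inter> ideal_of L \<gamma> = {}" by (rule bexE)
    have fil: "is_filter L \<xi>" using \<xi> ultrafilter_is_filter by simp
    have "dom (range_idem L \<alpha>) \<inter> dom d \<noteq> {}" using filter_meet[OF fil \<xi>(2) d(1)] .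
    then obtain \<delta> where \<delta>: "\<delta> \<in> dom d" "\<delta> \<in> ideal_of L \<alpha>" using dom_range_idem[OF am(1)] by blast
    have "\<delta> \<in> ideal_of L \<alpha> - (\<Union>\<beta>\<in>B. ideal_of L \<beta>)" using \<delta> d(2) by blast
    then obtain z x where "z \<in> Z" "x \<in> ideal_of L \<delta>" "x \<in> ideal_of L z"
      using exh unfolding meets_def by blast
    moreover have "x \<in> dom d" if "x \<in> ideal_of L \<delta>" for x
      using dom_ideal[OF idem_isg[OF filter_idem[OF fil d(1)]] \<delta>(1) that] .
    ultimately show False using d(2) by blast
  qed
qed

text \<open>Directedness gives one element of \<open>F\<close> above points chosen in the several
  domains, and domains are right ideals.\<close>

lemma path_finite_meet:
  assumes F: "F \<in> path_space_set L" and "finite X" "X \<subseteq> cat_idem L" "\<And>e. e \<in> X \<Longrightarrow> dom e \<inter> F \<noteq> {}"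
  shows "\<exists>\<alpha>\<in>F. \<forall>e\<in>X. \<alpha> \<in> dom e"
  using assms(2-4)
proof (induction X rule: finite_induct)
  case empty
  then show ?case using F unfolding path_space_set_def by blast
next
  case (insert e X)
  have "\<exists>\<alpha>\<in>F. \<forall>e\<in>X. \<alpha> \<in> dom e" using insert by (intro insert.IH) auto
  then obtain \<alpha> where a: "\<alpha> \<in> F" "\<forall>e\<in>X. \<alpha> \<in> dom e" by (elim bexE)
  have "dom e \<inter> F \<noteq> {}" using insert.prems(2) by simp
  then obtain \<beta> where b: "\<beta> \<in> F" "\<beta> \<in> dom e" by auto
  obtain \<gamma> where g: "\<gamma> \<in> F" "\<gamma> \<in> ideal_of L \<alpha>" "\<gamma> \<in> ideal_of L \<beta>"
    using path_directed[OF F a(1) b(1)] by (elim bexE conjE)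
  have "\<forall>d\<in>insert e X. \<gamma> \<in> dom d"
  proof
    fix d assume d: "d \<in> insert e X"
    then have "\<alpha> \<in> dom d \<or> \<beta> \<in> dom d" using a(2) b(2) by auto
    moreover have "d \<in> cat_isg L" using d insert.prems(1) idem_isg by auto
    ultimately show "\<gamma> \<in> dom d" using dom_ideal g(2,3) by metis
  qed
  then show ?case using g(1) by (rule bexI)
qed

text \<open>
  The case \<open>B = {}\<close> of the tightness condition already puts the filter into the closure of the
  ultrafilters: if every ultrafilter containing \<open>\<alpha>\<Lambda>\<close> met the finite set \<open>Y\<close> of excluded
  idempotents, then the generators of the sets \<open>\<alpha>\<Lambda> \<inter> dom f\<close>, \<open>f \<in> Y\<close>, would be exhaustive
  in \<open>\<alpha>\<Lambda>\<close>.
\<close>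

lemma path_filter_tightI:
  assumes F: "F \<in> path_space_set L"
    and tight: "\<And>\<alpha> Z. \<alpha> \<in> F \<Longrightarrow> finite Z \<Longrightarrow> Z \<subseteq> ideal_of L \<alpha> \<Longrightarrow>
      (\<forall>\<gamma>\<in>ideal_of L \<alpha>. \<exists>z\<in>Z. meets L \<gamma> z) \<Longrightarrow> F \<inter> Z \<noteq> {}"
  shows "path_filter F \<in> tight_filters L"
  unfolding tight_filters_def in_closure_of
proof (intro conjI allI impI)
  show "path_filter F \<in> topspace (filter_space L)"
    using is_filter_path_filter[OF F] topspace_filter_space by blast
  fix T assume T: "path_filter F \<in> T \<and> openin (filter_space L) T"
  let ?\<B> = "{{\<eta>. is_filter L \<eta> \<and> X \<subseteq> \<eta> \<and> Y \<inter> \<eta> = {}} | X Y.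
        finite X \<and> X \<subseteq> cat_idem L \<and> finite Y \<and> Y \<subseteq> cat_idem L}"
  have "\<exists>U\<in>?\<B>. path_filter F \<in> U \<and> U \<subseteq> T"
  proof (rule topology_generated_by_local_base)
    show "openin (topology_generated_by ?\<B>) T" "path_filter F \<in> T"
      using T unfolding filter_space_def by auto
    fix U V assume "U \<in> ?\<B>" "V \<in> ?\<B>"
    obtain X Y where U: "U = {\<eta>. is_filter L \<eta> \<and> X \<subseteq> \<eta> \<and> Y \<inter> \<eta> = {}}"
      and XY: "finite X" "X \<subseteq> cat_idem L" "finite Y" "Y \<subseteq> cat_idem L"
      using \<open>U \<in> ?\<B>\<close> by blast
    obtain X' Y' where V: "V = {\<eta>. is_filter L \<eta> \<and> X' \<subseteq> \<eta> \<and> Y' \<inter> \<eta> = {}}"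
      and XY': "finite X'" "X' \<subseteq> cat_idem L" "finite Y'" "Y' \<subseteq> cat_idem L"
      using \<open>V \<in> ?\<B>\<close> by blast
    have "U \<inter> V = {\<eta>. is_filter L \<eta> \<and> X \<union> X' \<subseteq> \<eta> \<and> (Y \<union> Y') \<inter> \<eta> = {}}"
      unfolding U V by auto
    moreover have "finite (X \<union> X')" "X \<union> X' \<subseteq> cat_idem L" "finite (Y \<union> Y')" "Y \<union> Y' \<subseteq> cat_idem L"
      using XY XY' by auto
    ultimately show "U \<inter> V \<in> ?\<B>" by blast
  qed
  then obtain U where "U \<in> ?\<B>" and U: "path_filter F \<in> U" "U \<subseteq> T" by blast
  from \<open>U \<in> ?\<B>\<close> obtain X Y where X: "finite X" "X \<subseteq> cat_idem L" and Y: "finite Y" "Y \<subseteq> cat_idem L"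
    and U_eq: "U = {\<eta>. is_filter L \<eta> \<and> X \<subseteq> \<eta> \<and> Y \<inter> \<eta> = {}}" by blast
  have XY: "X \<subseteq> path_filter F" "Y \<inter> path_filter F = {}"
    and sub: "{\<eta>. is_filter L \<eta> \<and> X \<subseteq> \<eta> \<and> Y \<inter> \<eta> = {}} \<subseteq> T"
    using U unfolding U_eq by auto
  \<comment> \<open>One \<alpha> absorbs all of \<open>X\<close>: every filter containing its
    idempotent contains \<open>X\<close>. What remains is to avoid \<open>Y\<close>.\<close>
  obtain \<alpha> where a: "\<alpha> \<in> F" "\<forall>e\<in>X. \<alpha> \<in> dom e"
    using path_finite_meet[OF F X] XY(1) unfolding path_filter_def by blast
  have am: "\<alpha> \<in> mor L" using a path_mor[OF F] by blast
  have "\<exists>\<xi>. is_ultrafilter L \<xi> \<and> range_idem L \<alpha> \<in> \<xi> \<and> Y \<inter> \<xi> = {}"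
  proof (rule ccontr)
    assume none: "\<not> ?thesis"
    have "finitely_generated L (dom f \<inter> ideal_of L \<alpha>)" if "f \<in> Y" for f
      using that Y(2) finitely_generated_ideal[OF am]
      by (intro finitely_generated_inter finitely_generated_dom idem_isg) auto
    then obtain G where G: "finite (G f) \<and> G f \<subseteq> mor L \<and> dom f \<inter> ideal_of L \<alpha> = (\<Union>\<gamma>\<in>G f. ideal_of L \<gamma>)"
      if "f \<in> Y" for f unfolding finitely_generated_def by metis
    have Gsub: "z \<in> dom f \<and> z \<in> ideal_of L \<alpha>" if "f \<in> Y" "z \<in> G f" for f z
      using G[OF that(1)] that(2) ideal_self by blast
    have "F \<inter> (\<Union>f\<in>Y. G f) \<noteq> {}"
    proof (rule tight[OF a(1)])
      show "finite (\<Union>f\<in>Y. G f)" using Y G by blast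
      show "(\<Union>f\<in>Y. G f) \<subseteq> ideal_of L \<alpha>" using Gsub by blast
      show "\<forall>\<gamma>\<in>ideal_of L \<alpha>. \<exists>z\<in>\<Union>f\<in>Y. G f. meets L \<gamma> z"
      proof
        fix \<gamma> assume \<gamma>: "\<gamma> \<in> ideal_of L \<alpha>"
        have gm: "\<gamma> \<in> mor L" using \<gamma> ideal_mor am by blast
        obtain \<xi> where \<xi>: "is_ultrafilter L \<xi>" "range_idem L \<gamma> \<in> \<xi>"
          using ultrafilter_exists[OF gm] by blast
        have fil: "is_filter L \<xi>" using \<xi> ultrafilter_is_filter by simp
        \<comment> \<open>An ultrafilter at \<gamma> is also one at \<alpha>, so the assumption
          \<open>none\<close> forces it to contain some \<open>f \<in> Y\<close>.\<close>
        have "range_idem L \<alpha> \<in> \<xi>"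
          using filter_range_idem_up[OF fil \<xi>(2) range_idem_in[OF am]] \<gamma> dom_range_idem[OF am] by blast
        then obtain f where f: "f \<in> Y" "f \<in> \<xi>" using none \<xi>(1) by blast
        have "dom f \<inter> dom (range_idem L \<gamma>) \<noteq> {}"
          using filter_meet[OF fil f(2) \<xi>(2)] .
        then obtain \<delta> where \<delta>: "\<delta> \<in> dom f" "\<delta> \<in> ideal_of L \<gamma>" using dom_range_idem[OF gm] by blast
        then have "\<delta> \<in> dom f \<inter> ideal_of L \<alpha>" using ideal_trans[OF am \<gamma>] by blast
        then show "\<exists>z\<in>\<Union>f\<in>Y. G f. meets L \<gamma> z"
          using G[OF f(1)] f(1) \<delta>(2) unfolding meets_def by blast
      qed
    qed
    then obtain f z where "f \<in> Y" "z \<in> G f" "z \<in> F" by blast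
    then have "f \<in> path_filter F" unfolding path_filter_def using Gsub Y(2) by blast
    then show False using \<open>f \<in> Y\<close> XY(2) by blast
  qed
  then obtain \<xi> where \<xi>: "is_ultrafilter L \<xi>" "range_idem L \<alpha> \<in> \<xi>" "Y \<inter> \<xi> = {}" by blast
  then have fil: "is_filter L \<xi>" unfolding is_ultrafilter_def by blast
  have "X \<subseteq> \<xi>" using filter_range_idem_up[OF fil \<xi>(2)] X(2) a(2) by blast
  then have "\<xi> \<in> T" using sub fil \<xi>(3) by blast
  then show "\<exists>y. y \<in> {\<eta>. is_ultrafilter L \<eta>} \<and> y \<in> T" using \<xi>(1) by blast
qed

text \<open>The instance \<open>B = {}\<close> of the definition, in the shape of the premise of
  \<open>path_filter_tightI\<close>.\<close>

lemma tight_pathD: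
  assumes "F \<in> tight_paths L" "\<alpha> \<in> F" "finite Z" "Z \<subseteq> ideal_of L \<alpha>"
    "\<forall>\<gamma>\<in>ideal_of L \<alpha>. \<exists>z\<in>Z. meets L \<gamma> z"
  shows "F \<inter> Z \<noteq> {}"
proof -
  let ?P = "\<lambda>\<alpha> B Z. finite B \<longrightarrow> B \<subseteq> mor L \<longrightarrow> B \<inter> F = {} \<longrightarrow>
       finite Z \<longrightarrow> Z \<subseteq> ideal_of L \<alpha> - (\<Union>\<beta>\<in>B. ideal_of L \<beta>) \<longrightarrow>
       (\<forall>\<gamma>\<in>ideal_of L \<alpha> - (\<Union>\<beta>\<in>B. ideal_of L \<beta>). \<exists>z\<in>Z. meets L \<gamma> z) \<longrightarrow> F \<inter> Z \<noteq> {}"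
  have "\<forall>\<alpha>\<in>F. \<forall>B Z. ?P \<alpha> B Z"
    using assms(1) unfolding tight_paths_def mem_Collect_eq by (rule conjunct2)
  then have "\<forall>B Z. ?P \<alpha> B Z" using assms(2) by (rule bspec)
  then have "?P \<alpha> {} Z" by (elim allE)
  then show ?thesis using assms(3-5) by simp
qed

lemma path_filter_tight:
  assumes "F \<in> tight_paths L" shows "path_filter F \<in> tight_filters L"
  by (rule path_filter_tightI[OF tight_path[OF assms] tight_pathD[OF assms]])

text \<open>An exhaustive \<open>Z\<close> above \<alpha> is pulled back along \<open>s\<close> to a
  finite exhaustive set above \<gamma>, where the value of \<open>s\<close> at \<gamma> extends
  \<alpha>. Tightness of \<open>F\<close> puts an element of it into \<open>F\<close>, and the image
  of that element extends some \<open>z \<in> Z\<close>. The conclusion concerns the filter because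
  \<open>germ_groupoids_isomorphic\<close> asks that the action preserve the unit space on that
  side.\<close>

lemma path_filter_push_tight:
  assumes s: "s \<in> cat_isg L" and F: "F \<in> tight_paths L" and meet: "F \<inter> dom s \<noteq> {}"
  shows "path_filter (push s F) \<in> tight_filters L"
proof (rule path_filter_tightI)
  have t: "translation L s" using s by (rule cat_isg_translation)
  show "push s F \<in> path_space_set L" using push_path[OF s tight_path[OF F] meet] .
  fix \<alpha> Z assume a: "\<alpha> \<in> push s F" and Z: "finite Z" "Z \<subseteq> ideal_of L \<alpha>"
    and exh: "\<forall>\<gamma>\<in>ideal_of L \<alpha>. \<exists>z\<in>Z. meets L \<gamma> z"
  obtain \<gamma> y where g: "\<alpha> \<in> mor L" "\<gamma> \<in> F" "y \<in> ideal_of L \<alpha>" "s \<gamma> = Some y"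
    using a unfolding push_def by blast
  have gm: "\<gamma> \<in> mor L" using g(2) path_mor tight_path F by blast
  have Zm: "Z \<subseteq> mor L" using Z(2) ideal_mor[OF g(1)] by blast
  \<comment> \<open>The part of \<open>\<gamma>\<Lambda>\<close> that \<open>s\<close> maps into
    \<open>z\<Lambda>\<close>. It corresponds under \<open>s\<close> to
    \<open>y\<Lambda> \<inter> z\<Lambda>\<close>, with \<open>y\<close> the value at \<gamma>, and
    need not be principal; hence the generating sets \<open>G z\<close> below.\<close>
  define P where "P z = {x \<in> ideal_of L \<gamma>. \<exists>y\<in>ideal_of L z. s x = Some y}" for z
  have "finitely_generated L (P z)" if "z \<in> Z" for z
  proof -
    have z: "z \<in> mor L" using that Zm by blast
    \<comment> \<open>Conjugation by the inverse of \<open>s\<close> exhibits the preimage as the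
      domain of a semigroup element, which gives finite generation.\<close>
    let ?e = "pinverse s \<circ>\<^sub>m range_idem L z \<circ>\<^sub>m pinverse (pinverse s)"
    have e: "?e \<in> cat_idem L" and d: "dom ?e = {x. \<exists>y\<in>dom (range_idem L z). pinverse s y = Some x}"
      using idem_conjugate[OF cat_isg.inverse[OF s] range_idem_in[OF z]] by blast+
    have "P z = dom ?e \<inter> ideal_of L \<gamma>"
      unfolding d P_def pinverse_translation[OF t] dom_range_idem[OF z] by blast
    then show ?thesis
      using finitely_generated_inter finitely_generated_dom[OF idem_isg[OF e]] finitely_generated_ideal[OF gm]
      by simp
  qed
  then obtain G where G: "finite (G z) \<and> G z \<subseteq> mor L \<and> P z = (\<Union>\<gamma>\<in>G z. ideal_of L \<gamma>)"
    if "z \<in> Z" for z unfolding finitely_generated_def by metis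
  have Gsub: "x \<in> P z" if "z \<in> Z" "x \<in> G z" for x z
    using G[OF that(1)] that(2) ideal_self by blast
  have "F \<inter> (\<Union>z\<in>Z. G z) \<noteq> {}"
  proof (rule tight_pathD[OF F g(2)])
    show "finite (\<Union>z\<in>Z. G z)" using Z(1) G by blast
    show "(\<Union>z\<in>Z. G z) \<subseteq> ideal_of L \<gamma>" using Gsub unfolding P_def by blast
    show "\<forall>x\<in>ideal_of L \<gamma>. \<exists>z\<in>\<Union>z\<in>Z. G z. meets L x z"
    proof
      fix x assume x: "x \<in> ideal_of L \<gamma>"
      obtain w where w: "w \<in> ideal_of L y" "s x = Some w" using translation_ideal[OF t g(4) x] by blast
      then obtain z v where z: "z \<in> Z" "v \<in> ideal_of L w" "v \<in> ideal_of L z"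
        using exh ideal_trans[OF g(1,3)] unfolding meets_def by blast
      obtain x' where x': "x' \<in> ideal_of L x" "s x' = Some v"
        using translation_ideal_image[OF t w(2) z(2)] by blast
      then have "x' \<in> P z" unfolding P_def using z(3) ideal_trans[OF gm x] by blast
      then show "\<exists>z\<in>\<Union>z\<in>Z. G z. meets L x z"
        using G[OF z(1)] z(1) x'(1) unfolding meets_def by blast
    qed
  qed
  then obtain z x where "z \<in> Z" "x \<in> P z" "x \<in> F" using Gsub by blast
  then have "z \<in> push s F" unfolding P_def push_def using Zm by blast
  then show "push s F \<inter> Z \<noteq> {}" using \<open>z \<in> Z\<close> by blast
qed


section \<open>The isomorphism\<close>

lemma topspace_tight_filters:
  "topspace (subtopology (filter_space L) (tight_filters L)) = tight_filters L"
  using topspace_filter_space tight_filter_is_filter by auto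

lemma topspace_tight_paths:
  "topspace (subtopology (path_space L) (tight_paths L)) = tight_paths L"
  using topspace_path_space tight_path by auto

text \<open>Membership of \<alpha> in the path is membership of one idempotent in the filter, so
  preimages of basic sets are again given by finite \<open>X\<close> and \<open>Y\<close>.\<close>

lemma continuous_map_filter_path:
  "continuous_map (subtopology (filter_space L) (tight_filters L))
     (subtopology (path_space L) (tight_paths L)) filter_path"
  unfolding continuous_map_in_subtopology
proof
  show "filter_path \<in> topspace (subtopology (filter_space L) (tight_filters L)) \<rightarrow> tight_paths L"
    unfolding topspace_tight_filters using tight_filter_path by blast
  show "continuous_map (subtopology (filter_space L) (tight_filters L)) (path_space L) filter_path"
    unfolding path_space_def continuous_on_generated_topo_iff
  proof (intro conjI allI impI)
    fix U assume "U \<in> {{F \<in> path_space_set L. X \<subseteq> F \<and> Y \<inter> F = {}} | X Y.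
        finite X \<and> X \<subseteq> mor L \<and> finite Y \<and> Y \<subseteq> mor L}"
    then obtain X Y where U: "U = {F \<in> path_space_set L. X \<subseteq> F \<and> Y \<inter> F = {}}"
      and fin: "finite X" "X \<subseteq> mor L" "finite Y" "Y \<subseteq> mor L" by blast
    let ?V = "{\<eta>. is_filter L \<eta> \<and> range_idem L ` X \<subseteq> \<eta> \<and> range_idem L ` Y \<inter> \<eta> = {}}"
    have "filter_path -` U \<inter> tight_filters L = ?V \<inter> tight_filters L"
      using filter_path_path tight_filter_prime tight_filter_is_filter fin
      unfolding U filter_path_def by auto
    moreover have "openin (filter_space L) ?V"
      using fin range_idem_in by (intro filter_space_basic_open) auto
    ultimately show "openin (subtopology (filter_space L) (tight_filters L))
        (filter_path -` U \<inter> topspace (subtopology (filter_space L) (tight_filters L)))"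
      unfolding topspace_tight_filters openin_subtopology by blast
  next
    have "filter_path ` tight_filters L \<subseteq> topspace (path_space L)"
      unfolding topspace_path_space using filter_path_path tight_filter_prime by blast
    then show "filter_path ` topspace (subtopology (filter_space L) (tight_filters L))
      \<subseteq> \<Union> {{F \<in> path_space_set L. X \<subseteq> F \<and> Y \<inter> F = {}} | X Y.
        finite X \<and> X \<subseteq> mor L \<and> finite Y \<and> Y \<subseteq> mor L}"
      unfolding topspace_tight_filters path_space_def by simp
  qed
qed

text \<open>Containing \<open>e\<close> means meeting the finite set \<open>G e\<close>. This is a
  disjunction, so preimages of basic sets need not be basic, and openness is checked pointwise: for
  \<open>e \<in> X\<close> one element of \<open>G e\<close> in the given path is fixed, for
  \<open>e \<in> Y\<close> all of \<open>G e\<close> is excluded.\<close>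

lemma continuous_map_path_filter:
  "continuous_map (subtopology (path_space L) (tight_paths L))
     (subtopology (filter_space L) (tight_filters L)) path_filter"
  unfolding continuous_map_in_subtopology
proof
  show "path_filter \<in> topspace (subtopology (path_space L) (tight_paths L)) \<rightarrow> tight_filters L"
    unfolding topspace_tight_paths using path_filter_tight by blast
  show "continuous_map (subtopology (path_space L) (tight_paths L)) (filter_space L) path_filter"
    unfolding filter_space_def continuous_on_generated_topo_iff
  proof (intro conjI allI impI)
    fix U assume "U \<in> {{\<eta>. is_filter L \<eta> \<and> X \<subseteq> \<eta> \<and> Y \<inter> \<eta> = {}} | X Y.
        finite X \<and> X \<subseteq> cat_idem L \<and> finite Y \<and> Y \<subseteq> cat_idem L}"
    then obtain X Y where U: "U = {\<eta>. is_filter L \<eta> \<and> X \<subseteq> \<eta> \<and> Y \<inter> \<eta> = {}}"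
      and fin: "finite X" "X \<subseteq> cat_idem L" "finite Y" "Y \<subseteq> cat_idem L" by blast
    have "\<forall>e\<in>cat_idem L. \<exists>\<Gamma>. finite \<Gamma> \<and> \<Gamma> \<subseteq> mor L \<and> dom e = (\<Union>\<gamma>\<in>\<Gamma>. ideal_of L \<gamma>)"
      using finitely_generated_dom idem_isg unfolding finitely_generated_def by blast
    then obtain G where G: "finite (G e) \<and> G e \<subseteq> mor L \<and> dom e = (\<Union>\<gamma>\<in>G e. ideal_of L \<gamma>)"
      if "e \<in> cat_idem L" for e by metis
    have meet: "dom e \<inter> F \<noteq> {} \<longleftrightarrow> G e \<inter> F \<noteq> {}" if "e \<in> cat_idem L" "F \<in> path_space_set L" for e F
      using G[OF that(1)] path_hereditary[OF that(2)] ideal_self by blast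
    show "openin (subtopology (path_space L) (tight_paths L))
        (path_filter -` U \<inter> topspace (subtopology (path_space L) (tight_paths L)))"
    proof (subst openin_subopen, intro ballI)
      fix F assume "F \<in> path_filter -` U \<inter> topspace (subtopology (path_space L) (tight_paths L))"
      then have FU: "path_filter F \<in> U" and F: "F \<in> tight_paths L" unfolding topspace_tight_paths by auto
      have P: "F \<in> path_space_set L" using F by (rule tight_path)
      have XF: "X \<subseteq> path_filter F" and YF: "Y \<inter> path_filter F = {}" using FU unfolding U by auto
      have "\<exists>\<beta>. \<beta> \<in> G e \<and> \<beta> \<in> F" if e: "e \<in> X" for e
      proof -
        have "e \<in> cat_idem L" "dom e \<inter> F \<noteq> {}" using e XF unfolding path_filter_def by auto
        then show ?thesis using meet[OF _ P] by auto
      qed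
      then obtain b where b: "b e \<in> G e \<and> b e \<in> F" if "e \<in> X" for e by metis
      have GX: "G e \<subseteq> mor L" if "e \<in> X" for e using G fin(2) that by auto
      have GY: "finite (G e)" "G e \<subseteq> mor L" if "e \<in> Y" for e using G fin(4) that by auto
      let ?Y = "\<Union>e\<in>Y. G e"
      let ?V = "{F \<in> path_space_set L. b ` X \<subseteq> F \<and> ?Y \<inter> F = {}}"
      have "openin (path_space L) ?V"
      proof (rule path_space_basic_open)
        show "b ` X \<subseteq> mor L" using b GX by auto
        show "?Y \<subseteq> mor L" "finite ?Y" using GY fin(3) by auto
      qed (use fin in simp)
      then have "openin (subtopology (path_space L) (tight_paths L)) (?V \<inter> tight_paths L)"
        unfolding openin_subtopology by auto
      moreover have "F \<in> ?V \<inter> tight_paths L"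
      proof -
        have "G e \<inter> F = {}" if e: "e \<in> Y" for e
        proof -
          have "e \<in> cat_idem L" "dom e \<inter> F = {}" using e YF fin(4) unfolding path_filter_def by auto
          then show ?thesis using meet[OF _ P] by auto
        qed
        then show ?thesis using F P b by auto
      qed
      moreover have "?V \<inter> tight_paths L
          \<subseteq> path_filter -` U \<inter> topspace (subtopology (path_space L) (tight_paths L))"
      proof
        fix F' assume F': "F' \<in> ?V \<inter> tight_paths L"
        then have P': "F' \<in> path_space_set L" and t: "F' \<in> tight_paths L" by auto
        have "e \<in> path_filter F'" if e: "e \<in> X" for e
        proof -
          have "e \<in> cat_idem L" "G e \<inter> F' \<noteq> {}" using e fin(2) b[OF e] F' by auto
          then show ?thesis using meet[OF _ P'] unfolding path_filter_def by simp
        qed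
        moreover have "e \<notin> path_filter F'" if e: "e \<in> Y" for e
        proof -
          have "e \<in> cat_idem L" "G e \<inter> F' = {}" using e fin(4) F' by auto
          then show ?thesis using meet[OF _ P'] unfolding path_filter_def by simp
        qed
        ultimately have "path_filter F' \<in> U"
          unfolding U using is_filter_path_filter[OF P'] by auto
        then show "F' \<in> path_filter -` U \<inter> topspace (subtopology (path_space L) (tight_paths L))"
          unfolding topspace_tight_paths using t by simp
      qed
      ultimately show "\<exists>T. openin (subtopology (path_space L) (tight_paths L)) T \<and> F \<in> T \<and>
          T \<subseteq> path_filter -` U \<inter> topspace (subtopology (path_space L) (tight_paths L))"
        by blast
    qed
  next
    have "path_filter ` tight_paths L \<subseteq> topspace (filter_space L)"
      unfolding topspace_filter_space using is_filter_path_filter tight_path by blast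
    then show "path_filter ` topspace (subtopology (path_space L) (tight_paths L))
      \<subseteq> \<Union> {{\<eta>. is_filter L \<eta> \<and> X \<subseteq> \<eta> \<and> Y \<inter> \<eta> = {}} | X Y.
        finite X \<and> X \<subseteq> cat_idem L \<and> finite Y \<and> Y \<subseteq> cat_idem L}"
      unfolding topspace_tight_paths filter_space_def by simp
  qed
qed

lemma homeomorphic_map_filter_path:
  "homeomorphic_map (subtopology (filter_space L) (tight_filters L))
     (subtopology (path_space L) (tight_paths L)) filter_path"
proof -
  have "homeomorphic_maps (subtopology (filter_space L) (tight_filters L))
     (subtopology (path_space L) (tight_paths L)) filter_path path_filter"
    unfolding homeomorphic_maps_def topspace_tight_filters topspace_tight_paths
    using continuous_map_filter_path continuous_map_path_filter
      filter_path_path_filter[OF tight_path] path_filter_filter_path[OF tight_filter_prime] by blast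
  then show ?thesis using homeomorphic_map_maps by blast
qed

lemma filter_action_simps:
  "isg (filter_action L) = cat_isg L" "imul (filter_action L) = (\<circ>\<^sub>m)" "istar (filter_action L) = pinverse"
  "space_of (filter_action L) = subtopology (filter_space L) (tight_filters L)"
  "adom (filter_action L) s = {\<eta> \<in> tight_filters L. pinverse s \<circ>\<^sub>m s \<in> \<eta>}"
  unfolding filter_action_def by simp_all

lemma adom_filter_action:
  assumes "s \<in> cat_isg L" "\<eta> \<in> tight_filters L"
  shows "\<eta> \<in> adom (filter_action L) s \<longleftrightarrow> filter_path \<eta> \<inter> dom s \<noteq> {}"
proof -
  have "pinverse s \<circ>\<^sub>m s \<in> \<eta> \<longleftrightarrow> dom s \<inter> filter_path \<eta> \<noteq> {}"
    unfolding prime_filter_mem[OF tight_filter_prime[OF assms(2)] idem_pinverse_comp(1)[OF assms(1)]]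
      idem_pinverse_comp(2)[OF assms(1)] by (rule refl)
  then show ?thesis unfolding filter_action_simps using assms(2) by auto
qed

text \<open>A conjugate of \<open>e\<close> has the image of \<open>dom e\<close> as its domain, and
  a point of \<open>F\<close> in \<open>dom e \<inter> dom s\<close> is moved into
  \<open>push s F\<close>. Conversely, if the value of \<open>s\<close> at \<gamma> extends \<alpha>
  in \<open>dom f\<close>, then the identity of \<open>\<gamma>\<Lambda>\<close> is small enough to
  serve as \<open>e\<close>.\<close>

lemma act_filter_action:
  assumes s: "s \<in> cat_isg L" and F: "F \<in> path_space_set L" and meet: "F \<inter> dom s \<noteq> {}"
  shows "act (filter_action L) s (path_filter F) = path_filter (push s F)"
proof -
  have t: "translation L s" using s by (rule cat_isg_translation)
  have "(\<exists>e\<in>path_filter F. idem_le (s \<circ>\<^sub>m e \<circ>\<^sub>m pinverse s) f) \<longleftrightarrow> dom f \<inter> push s F \<noteq> {}"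
    if f: "f \<in> cat_idem L" for f
  proof
    assume "\<exists>e\<in>path_filter F. idem_le (s \<circ>\<^sub>m e \<circ>\<^sub>m pinverse s) f"
    then obtain e where "e \<in> path_filter F" and le: "idem_le (s \<circ>\<^sub>m e \<circ>\<^sub>m pinverse s) f"
      by (elim bexE)
    then have e: "e \<in> cat_idem L" "F \<inter> dom e \<noteq> {}" unfolding path_filter_def by auto
    have sub: "{y. \<exists>x\<in>dom e. s x = Some y} \<subseteq> dom f"
      using le idem_le_iff[OF idem_conjugate(1)[OF s e(1)] f] idem_conjugate(2)[OF s e(1)] by simp
    obtain \<gamma> where "\<gamma> \<in> F" "\<gamma> \<in> dom e" "\<gamma> \<in> dom s"
      using path_meets_inter[OF F idem_isg[OF e(1)] s e(2) meet] by auto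
    then obtain y where "s \<gamma> = Some y" by auto
    then have "y \<in> dom f" "y \<in> push s F" using sub \<open>\<gamma> \<in> dom e\<close> push_memI[OF s \<open>\<gamma> \<in> F\<close>] by auto
    then show "dom f \<inter> push s F \<noteq> {}" by auto
  next
    assume "dom f \<inter> push s F \<noteq> {}"
    then obtain \<alpha> where "\<alpha> \<in> dom f" "\<alpha> \<in> push s F" by auto
    then obtain \<gamma> y where g: "\<alpha> \<in> dom f" "\<gamma> \<in> F" "y \<in> ideal_of L \<alpha>" "s \<gamma> = Some y"
      unfolding push_def by auto
    have gm: "\<gamma> \<in> mor L" using g(2) path_mor[OF F] by blast
    note e = range_idem_in[OF gm] dom_range_idem[OF gm]
    have "x \<in> dom f" if "x \<in> ideal_of L y" for x
      by (rule dom_ideal[OF idem_isg[OF f] dom_ideal[OF idem_isg[OF f] g(1,3)] that])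
    then have "{y. \<exists>x\<in>ideal_of L \<gamma>. s x = Some y} \<subseteq> dom f"
      using translation_ideal[OF t g(4)] by fastforce
    then have "idem_le (s \<circ>\<^sub>m range_idem L \<gamma> \<circ>\<^sub>m pinverse s) f"
      using idem_le_iff[OF idem_conjugate(1)[OF s e(1)] f] idem_conjugate(2)[OF s e(1)] e(2) by simp
    moreover have "range_idem L \<gamma> \<in> path_filter F"
      unfolding path_filter_def using e ideal_self[OF gm] g(2) by auto
    ultimately show "\<exists>e\<in>path_filter F. idem_le (s \<circ>\<^sub>m e \<circ>\<^sub>m pinverse s) f" by (rule bexI)
  qed
  then show ?thesis
    unfolding filter_action_def isg_action.simps path_filter_def[of "push s F"]
    by (intro Collect_cong conj_cong refl)
qed

lemma topologically_isomorphic_tight_path_groupoid: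
  "topologically_isomorphic (tight_groupoid L) (path_groupoid L)"
  unfolding tight_groupoid_def path_groupoid_def
proof (rule germ_groupoids_isomorphic[where f = filter_path])
  have act: "act (filter_action L) s \<eta> = path_filter (push s (filter_path \<eta>))
      \<and> filter_path \<eta> \<in> tight_paths L \<and> filter_path \<eta> \<inter> dom s \<noteq> {}"
    if s: "s \<in> cat_isg L" and \<eta>: "\<eta> \<in> adom (filter_action L) s" for s \<eta>
  proof -
    have t: "\<eta> \<in> tight_filters L" using \<eta> unfolding filter_action_simps by blast
    have F: "filter_path \<eta> \<in> tight_paths L" using tight_filter_path[OF t] .
    have m: "filter_path \<eta> \<inter> dom s \<noteq> {}" using adom_filter_action[OF s t] \<eta> by blast
    \<comment> \<open>Rewriting the filter as that of its path makes
      \<open>act_filter_action\<close>, stated for paths, applicable.\<close>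
    have "path_filter (filter_path \<eta>) = \<eta>"
      using path_filter_filter_path[OF tight_filter_prime[OF t]] .
    then show ?thesis using act_filter_action[OF s tight_path[OF F] m] F m by simp
  qed
  fix s \<eta>
  assume "s \<in> isg (path_action L)"
  then have s: "s \<in> cat_isg L" unfolding path_action_simps .
  show "adom (filter_action L) s \<subseteq> topspace (space_of (filter_action L))"
    unfolding filter_action_simps topspace_tight_filters by blast
  show "adom (path_action L) s \<subseteq> topspace (space_of (path_action L))"
    unfolding path_action_simps topspace_tight_paths adom_path_action[OF s] by blast
  show "filter_path \<eta> \<in> adom (path_action L) s \<longleftrightarrow> \<eta> \<in> adom (filter_action L) s"
    if "\<eta> \<in> topspace (space_of (filter_action L))"
    using that adom_filter_action[OF s] tight_filter_path
    unfolding filter_action_simps(4) topspace_tight_filters adom_path_action[OF s] by blast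
  assume \<eta>: "\<eta> \<in> adom (filter_action L) s"
  show "act (filter_action L) s \<eta> \<in> topspace (space_of (filter_action L))"
    unfolding filter_action_simps topspace_tight_filters
    using act[OF s \<eta>] path_filter_push_tight[OF s] by simp
  show "act (path_action L) s (filter_path \<eta>) = filter_path (act (filter_action L) s \<eta>)"
    using act[OF s \<eta>] act_path_action[OF s tight_path] push_path[OF s tight_path]
      filter_path_path_filter by simp
qed (simp_all add: filter_action_simps path_action_simps homeomorphic_map_filter_path
    germ_action_path_action)

end

theorem lemma4p9:
  fixes L :: "'a cat"
  assumes "small_category L"
    and "left_cancellative L"
    and "finitely_aligned L"
  shows "topologically_isomorphic (tight_groupoid L) (path_groupoid L)"
proof -
  interpret finitely_aligned_lcsc L using assms by unfold_locales
  show ?thesis by (rule topologically_isomorphic_tight_path_groupoid)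
qed

end
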